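(* Let $\mathcal M$ be an internal unital $C^*$-algebra with nonstandard hull $\widehat{\mathcal M}$. (i) Let $a\in\mathrm{Fin}(\mathcal M)$. Then $\widehat a\in(\widehat{\mathcal M})_+$ if and only if there exists $c\in\mathcal M_+$ such that $\widehat a=\widehat c$. Therefore $(\widehat{\mathcal M})_+=\widehat{(\mathcal M_+)}$. (ii) Let $a\in\mathrm{Fin}(\mathcal M)$. Then $\widehat a\in\mathrm{Re}(\widehat{\mathcal M})$ if and only if there exists $c\in\mathrm{Re}(\mathcal M)$ such that $\widehat a=\widehat c$. Therefore $\mathrm{Re}(\widehat{\mathcal M})=\widehat{\mathrm{Re}(\mathcal M)}$. (iii) Let $m_1,m_2\in\widehat{\mathcal M}$. Then $m_1\le m_2$ if and only if there are $a,b\in\mathrm{Fin}(\mathcal M)$ such that $m_1=\widehat a$, $m_2=\widehat b$ and $a\le b$. Moreover, if $m_1\in(\widehat{\mathcal M})_+$, we can take $a,b\in\mathrm{Fin}(\mathcal M_+)$.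
   Context: Work in a nonstandard universe (in the sense of Robinson's nonstandard analysis) that is $\kappa$-saturated for a sufficiently large uncountable cardinal $\kappa$. All $C^*$-algebras are unital. An internal $C^*$-algebra $\mathcal M$ is an internal object satisfying (by transfer) the definition of a $C^*$-algebra over ${}^*\mathbb C$, with norm valued in ${}^*\mathbb R$. For $r,s\in{}^*\mathbb R$, $r\approx s$ means $|r-s|<1/n$ for all standard $n\ge 1$; $r$ is finite ($|r|<\infty$) if $|r|<n$ for some standard $n$, and then ${}^\circ r\in\mathbb R$ is its standard part. For $X\subseteq\mathcal M$ put $\mathrm{Fin}(X)=\{a\in X:\|a\|<\infty\}$; $a\approx b$ means $\|a-b\|\approx 0$; $\widehat a=\{x\in\mathcal M: x\approx a\}$; $\widehat X=\{\widehat a:a\in\mathrm{Fin}(X)\}$. The nonstandard hull is $\widehat{\mathcal M}=\{\widehat a: a\in\mathrm{Fin}(\mathcal M)\}$ with $\widehat a+\widehat b=\widehat{a+b}$, $\widehat a\,\widehat b=\widehat{ab}$, $(\widehat a)^*=\widehat{a^*}$, unit $\widehat 1$, scalar multiplication induced likewise, and $\|\widehat a\|={}^\circ\|a\|$; it is an ordinary $C^*$-algebra. For a $C^*$-algebra $\mathcal N$, $\mathrm{Re}(\mathcal N)$ is the set of self-adjoint elements, $\mathcal N_+=\{a^2:a\in\mathrm{Re}(\mathcal N)\}$ the set of positive elements, and for $a,b\in\mathcal N$, $a\le b$ means $b-a\in\mathcal N_+$. *)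

theory Defs
  imports Complex_Main "HOL-Algebra.Module"
begin

unbundle cardinal_syntax

section \<open>Unital C*-algebras\<close>

text \<open>
  One record type serves three purposes: ordinary algebras (scalars \<open>complex\<close>, norms \<open>real\<close>), internal
  algebras (scalars in the nonstandard complex numbers, norms in the nonstandard reals) and
  nonstandard hulls.
\<close>

record ('k, 'r, 'e) star_algebra = "('k, 'e) module" +
  adj :: "'e \<Rightarrow> 'e"
  nrm :: "'e \<Rightarrow> 'r"

definition complex_ring :: "complex ring" where
  "complex_ring = \<lparr>carrier = UNIV, mult = (*), one = 1, zero = 0, add = (+)\<rparr>"

locale cstar_algebra = module complex_ring A + ring A
  for A :: "(complex, real, 'e) star_algebra" (structure) +
  assumes smult_mult_left:
      "\<lbrakk>x \<in> carrier A; y \<in> carrier A\<rbrakk> \<Longrightarrow> (c \<odot>\<^bsub>A\<^esub> x) \<otimes>\<^bsub>A\<^esub> y = c \<odot>\<^bsub>A\<^esub> (x \<otimes>\<^bsub>A\<^esub> y)"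
    and smult_mult_right:
      "\<lbrakk>x \<in> carrier A; y \<in> carrier A\<rbrakk> \<Longrightarrow> x \<otimes>\<^bsub>A\<^esub> (c \<odot>\<^bsub>A\<^esub> y) = c \<odot>\<^bsub>A\<^esub> (x \<otimes>\<^bsub>A\<^esub> y)"
    and adj_closed: "x \<in> carrier A \<Longrightarrow> adj A x \<in> carrier A"
    and adj_adj: "x \<in> carrier A \<Longrightarrow> adj A (adj A x) = x"
    and adj_add:
      "\<lbrakk>x \<in> carrier A; y \<in> carrier A\<rbrakk> \<Longrightarrow> adj A (x \<oplus>\<^bsub>A\<^esub> y) = adj A x \<oplus>\<^bsub>A\<^esub> adj A y"
    and adj_smult: "x \<in> carrier A \<Longrightarrow> adj A (c \<odot>\<^bsub>A\<^esub> x) = cnj c \<odot>\<^bsub>A\<^esub> adj A x"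
    and adj_mult:
      "\<lbrakk>x \<in> carrier A; y \<in> carrier A\<rbrakk> \<Longrightarrow> adj A (x \<otimes>\<^bsub>A\<^esub> y) = adj A y \<otimes>\<^bsub>A\<^esub> adj A x"
    and nrm_nonneg: "x \<in> carrier A \<Longrightarrow> 0 \<le> nrm A x"
    and nrm_eq_0: "x \<in> carrier A \<Longrightarrow> nrm A x = 0 \<longleftrightarrow> x = \<zero>\<^bsub>A\<^esub>"
    and nrm_smult: "x \<in> carrier A \<Longrightarrow> nrm A (c \<odot>\<^bsub>A\<^esub> x) = cmod c * nrm A x"
    and nrm_add:
      "\<lbrakk>x \<in> carrier A; y \<in> carrier A\<rbrakk> \<Longrightarrow> nrm A (x \<oplus>\<^bsub>A\<^esub> y) \<le> nrm A x + nrm A y"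
    and nrm_mult:
      "\<lbrakk>x \<in> carrier A; y \<in> carrier A\<rbrakk> \<Longrightarrow> nrm A (x \<otimes>\<^bsub>A\<^esub> y) \<le> nrm A x * nrm A y"
    and cstar_identity: "x \<in> carrier A \<Longrightarrow> nrm A (adj A x \<otimes>\<^bsub>A\<^esub> x) = (nrm A x)\<^sup>2"
    and complete:
      "\<lbrakk>\<And>n. X n \<in> carrier A;
        \<And>\<epsilon>. \<epsilon> > 0 \<Longrightarrow> \<exists>N. \<forall>m\<ge>N. \<forall>n\<ge>N. nrm A (X m \<ominus>\<^bsub>A\<^esub> X n) < \<epsilon>\<rbrakk>
       \<Longrightarrow> \<exists>x\<in>carrier A. (\<lambda>n. nrm A (X n \<ominus>\<^bsub>A\<^esub> x)) \<longlonglongrightarrow> 0"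

definition self_adjoint :: "('k, 'r, 'e) star_algebra \<Rightarrow> 'e set" where
  "self_adjoint A = {a \<in> carrier A. adj A a = a}"

definition positive :: "('k, 'r, 'e) star_algebra \<Rightarrow> 'e set" where
  "positive A = {a \<otimes>\<^bsub>A\<^esub> a | a. a \<in> self_adjoint A}"

definition below :: "('k, 'r, 'e) star_algebra \<Rightarrow> 'e \<Rightarrow> 'e \<Rightarrow> bool" where
  "below A a b \<longleftrightarrow> b \<ominus>\<^bsub>A\<^esub> a \<in> positive A"


section \<open>Saturated nonstandard universes\<close>

text \<open>
  The type \<open>'u\<close> holds the standard individuals and \<open>'n\<close> the individuals of its nonstandard
  extension. Nothing is assumed about \<open>'u\<close> except that it contains the complex numbers (and hence the
  reals) through \<open>num\<close>; it may for instance be a level \<open>V\<^sub>m\<close> of a superstructure, with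
  \<open>'n\<close> its extension \<open>*V\<^sub>m\<close>, and then sets, functions and tuples are individuals as well.
  The star map acts on individuals (\<open>star_el\<close>) and on relations between individuals
  (\<open>star_rel\<close>); a relation is a set of lists, a \<open>k\<close>-ary one consisting of lists of length \<open>k\<close>.
\<close>

record ('u, 'n) universe =
  num :: "complex \<Rightarrow> 'u"
  star_el :: "'u \<Rightarrow> 'n"
  star_rel :: "'u list set \<Rightarrow> 'n list set"

text \<open>
  Formulas of the language with a symbol for every standard relation; variables are natural numbers.
  The first argument of \<open>holds\<close> interprets the relation symbols.
\<close>

datatype 'u formula =
    Rel "'u list set" "nat list"
  | Eq nat nat
  | Neg "'u formula"
  | Conj "'u formula" "'u formula"
  | All nat "'u formula"

primrec holds :: "('u list set \<Rightarrow> 'd list set) \<Rightarrow> (nat \<Rightarrow> 'd) \<Rightarrow> 'u formula \<Rightarrow> bool" where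
  "holds S v (Rel R xs) \<longleftrightarrow> map v xs \<in> S R"
| "holds S v (Eq x y) \<longleftrightarrow> v x = v y"
| "holds S v (Neg p) \<longleftrightarrow> \<not> holds S v p"
| "holds S v (Conj p q) \<longleftrightarrow> holds S v p \<and> holds S v q"
| "holds S v (All x p) \<longleftrightarrow> (\<forall>d. holds S (v(x := d)) p)"

definition transfer_principle :: "('u, 'n) universe \<Rightarrow> bool" where
  "transfer_principle V \<longleftrightarrow>
    (\<forall>p v. holds (\<lambda>R. R) v p \<longleftrightarrow> holds (star_rel V) (star_el V \<circ> v) p)"

text \<open>
  Internal sets are the sections, at nonstandard parameters, of the extensions of standard relations.
\<close>

definition internal_set :: "('u, 'n) universe \<Rightarrow> 'n set \<Rightarrow> bool" where
  "internal_set V X \<longleftrightarrow> (\<exists>R ps. X = {x. ps @ [x] \<in> star_rel V R})"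

definition saturated :: "'k rel \<Rightarrow> ('u, 'n) universe \<Rightarrow> bool" where
  "saturated \<kappa> V \<longleftrightarrow>
    (\<forall>\<F>. (\<forall>X\<in>\<F>. internal_set V X) \<and> |\<F>| <o \<kappa> \<and>
         (\<forall>\<G>\<subseteq>\<F>. finite \<G> \<longrightarrow> \<Inter>\<G> \<noteq> {}) \<longrightarrow> \<Inter>\<F> \<noteq> {})"

definition saturated_nonstandard_universe :: "'k rel \<Rightarrow> ('u, 'n) universe \<Rightarrow> bool" where
  "saturated_nonstandard_universe \<kappa> V \<longleftrightarrow>
    inj (num V) \<and> transfer_principle V \<and> Card_order \<kappa> \<and> natLeq <o \<kappa> \<and> saturated \<kappa> V"

text \<open>Application of the extension of a standard function, given by its graph.\<close>

definition star_app :: "('u, 'n) universe \<Rightarrow> 'u list set \<Rightarrow> 'n list \<Rightarrow> 'n" where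
  "star_app V G xs = (THE y. xs @ [y] \<in> star_rel V G)"

abbreviation rnum :: "('u, 'n) universe \<Rightarrow> real \<Rightarrow> 'u" where
  "rnum V r \<equiv> num V (complex_of_real r)"

definition approx :: "('u, 'n) universe \<Rightarrow> 'n \<Rightarrow> 'n \<Rightarrow> bool" where
  "approx V r s \<longleftrightarrow>
    (\<forall>n::nat. n \<ge> 1 \<longrightarrow> [r, s] \<in> star_rel V {[rnum V x, rnum V y] | x y. \<bar>x - y\<bar> < 1 / real n})"

definition finite_hyperreal :: "('u, 'n) universe \<Rightarrow> 'n \<Rightarrow> bool" where
  "finite_hyperreal V r \<longleftrightarrow> (\<exists>n::nat. [r] \<in> star_rel V {[rnum V x] | x. \<bar>x\<bar> < real n})"

definition standard_part :: "('u, 'n) universe \<Rightarrow> 'n \<Rightarrow> real" where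
  "standard_part V r = (THE t. approx V r (star_el V (rnum V t)))"


section \<open>Internal C*-algebras\<close>

text \<open>
  Let \<open>A\<close> assign to each standard individual \<open>i\<close> the structure on individuals that \<open>i\<close> stands for.
  By transfer every nonstandard individual \<open>\<nu>\<close> stands for the internal structure below: its
  carrier is \<open>{x. x \<in> *carrier(\<nu>)}\<close>, its product is \<open>(x, y) \<mapsto> *mult(\<nu>, x, y)\<close>, and so on. The
  operations have no meaning outside the carrier or at scalars that are not nonstandard complex
  numbers.
\<close>

definition internal_structure ::
  "('u, 'n) universe \<Rightarrow> ('u \<Rightarrow> (complex, real, 'u) star_algebra) \<Rightarrow> 'n \<Rightarrow> ('n, 'n, 'n) star_algebra"
where
  "internal_structure V A \<nu> = \<lparr>
     carrier = {x. [\<nu>, x] \<in> star_rel V {[i, x] | i x. x \<in> carrier (A i)}},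
     mult = (\<lambda>x y. star_app V {[i, x, y, x \<otimes>\<^bsub>A i\<^esub> y] | i x y. True} [\<nu>, x, y]),
     one = star_app V {[i, \<one>\<^bsub>A i\<^esub>] | i. True} [\<nu>],
     zero = star_app V {[i, \<zero>\<^bsub>A i\<^esub>] | i. True} [\<nu>],
     add = (\<lambda>x y. star_app V {[i, x, y, x \<oplus>\<^bsub>A i\<^esub> y] | i x y. True} [\<nu>, x, y]),
     smult = (\<lambda>c x. star_app V {[i, num V c, x, c \<odot>\<^bsub>A i\<^esub> x] | i c x. True} [\<nu>, c, x]),
     adj = (\<lambda>x. star_app V {[i, x, adj (A i) x] | i x. True} [\<nu>, x]),
     nrm = (\<lambda>x. star_app V {[i, x, rnum V (nrm (A i) x)] | i x. True} [\<nu>, x])\<rparr>"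

text \<open>
  An internal structure satisfies the definition of a C*-algebra by transfer when its code lies in
  the extension of the set of codes of C*-algebras. The assignment \<open>A\<close> is arbitrary, so internal
  members of any standard set of C*-algebras are covered.
\<close>

definition internal_cstar_algebra :: "('u, 'n) universe \<Rightarrow> ('n, 'n, 'n) star_algebra \<Rightarrow> bool" where
  "internal_cstar_algebra V M \<longleftrightarrow>
    (\<exists>A \<nu>. [\<nu>] \<in> star_rel V {[i] | i. cstar_algebra (A i)} \<and> M = internal_structure V A \<nu>)"


section \<open>The nonstandard hull\<close>

definition fin_part :: "('u, 'n) universe \<Rightarrow> ('n, 'n, 'n) star_algebra \<Rightarrow> 'n set \<Rightarrow> 'n set" where
  "fin_part V M X = {a \<in> X. finite_hyperreal V (nrm M a)}"

definition hat :: "('u, 'n) universe \<Rightarrow> ('n, 'n, 'n) star_algebra \<Rightarrow> 'n \<Rightarrow> 'n set" where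
  "hat V M a = {x \<in> carrier M. approx V (nrm M (x \<ominus>\<^bsub>M\<^esub> a)) (star_el V (rnum V 0))}"

definition hat_set :: "('u, 'n) universe \<Rightarrow> ('n, 'n, 'n) star_algebra \<Rightarrow> 'n set \<Rightarrow> 'n set set" where
  "hat_set V M X = hat V M ` fin_part V M X"

definition rep :: "'n set \<Rightarrow> 'n" where
  "rep P = (SOME a. a \<in> P)"

text \<open>
  The operations are computed on chosen representatives; for classes of finite elements the result
  does not depend on the choice.
\<close>

definition nonstandard_hull ::
  "('u, 'n) universe \<Rightarrow> ('n, 'n, 'n) star_algebra \<Rightarrow> (complex, real, 'n set) star_algebra"
where
  "nonstandard_hull V M = \<lparr>
     carrier = hat_set V M (carrier M),
     mult = (\<lambda>P Q. hat V M (rep P \<otimes>\<^bsub>M\<^esub> rep Q)),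
     one = hat V M \<one>\<^bsub>M\<^esub>,
     zero = hat V M \<zero>\<^bsub>M\<^esub>,
     add = (\<lambda>P Q. hat V M (rep P \<oplus>\<^bsub>M\<^esub> rep Q)),
     smult = (\<lambda>c P. hat V M (star_el V (num V c) \<odot>\<^bsub>M\<^esub> rep P)),
     adj = (\<lambda>P. hat V M (adj M (rep P))),
     nrm = (\<lambda>P. standard_part V (nrm M (rep P)))\<rparr>"

end

(*
  Fix finitely many nonstandard individuals. The sets of standard tuples whose extension contains
  them form an ultrafilter, and by transfer every internal operation on them is computed pointwise
  modulo this ultrafilter. So internal statements reduce to statements about ordinary C*-algebras,
  infinitesimal norms are those tending to 0 along the ultrafilter, and finite norms those
  eventually bounded.

  If a* is infinitely close to a, then (a* + a)/2 is self-adjoint and infinitely close to a; hence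
  self-adjoint elements of the hull, and squares of such, lift. For m1 <= m2 with m1 = hat a, lift
  the positive element m2 - m1 to some c and take b = a + c. If a is positive, so is a + c, because
  in a C*-algebra a sum of two squares of self-adjoint elements is again such a square. After
  scaling, this follows without spectral theory: 1 - t has a self-adjoint square root when
  norm t <= 1 (limit of w -> (t + w^2)/2), and norm (1 - x^2) <= 1 when norm x <= 1, so 1 - (x^2 + y^2)/2
  has norm at most 1.
*)
theory Submission
  imports Defs "HOL-Algebra.Multiplicative_Group"
begin

section \<open>Transfer and ultrapowers\<close>

text \<open>Completeness of an internal algebra concerns internal sequences, so the limit that
  defines a square root is not taken inside \<open>M\<close>. It is taken in the ordinary
  C*-algebras that serve as factors; one root chosen for each index gives a function, and its value
  under \<open>e\<close> is the internal root. The universe is given by first-order transfer for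
  relations, not as an ultrapower, hence the factors have to be recovered first. The iteration comes
  from (1 - w)^2 = 1 - t, that is 2 w = t + w^2. Positivity means being the square of a self-adjoint
  element, so closure under sums is a genuine theorem about C*-algebras. The critical estimate is
  norm (1 - x^2) \<le> 1: the triangle inequality yields only the bound 2, with which the iteration
  could not be started for 1 - (x^2 + y^2)/2.\<close>

primrec variable_bound :: "'u formula \<Rightarrow> nat" where
  "variable_bound (Rel R xs) = Suc (Max (set (0 # xs)))"
| "variable_bound (Eq x y) = Suc (max x y)"
| "variable_bound (Neg p) = variable_bound p"
| "variable_bound (Conj p q) = max (variable_bound p) (variable_bound q)"
| "variable_bound (All x p) = variable_bound p"

text \<open>A formula sees finitely many variables, so an assignment may be altered from
  \<open>variable_bound p\<close> on. This reduces an arbitrary assignment to one that a finite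
  block of quantifiers can reach.\<close>

lemma holds_cong:
  "(\<And>n. n < variable_bound p \<Longrightarrow> v n = w n) \<Longrightarrow> holds S v p = holds S w p"
proof (induction p arbitrary: v w)
  case (Rel R xs)
  have "map v xs = map w xs"
    by (rule map_cong[OF refl], rule Rel) (simp add: less_Suc_eq_le)
  then show ?case by (simp only: holds.simps)
next
  case (All x p)
  have "holds S (v(x := d)) p = holds S (w(x := d)) p" for d
    using All.prems by (intro All.IH) simp
  then show ?case by simp
next
  case (Conj p q)
  have "holds S v p = holds S w p"
    by (rule Conj.IH(1), rule Conj.prems) simp
  moreover have "holds S v q = holds S w q"
    by (rule Conj.IH(2), rule Conj.prems) simp
  ultimately show ?case by (simp only: holds.simps)
next
  case (Neg p)
  have "holds S v p = holds S w p"
    by (rule Neg.IH, rule Neg.prems) simp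
  then show ?case by (simp only: holds.simps)
next
  case (Eq x y)
  have "v x = w x" "v y = w y"
    by (rule Eq, simp)+
  then show ?case by (simp only: holds.simps)
qed

lemma holds_foldr_All:
  "holds S v (foldr All ns p) \<longleftrightarrow> (\<forall>w. (\<forall>n. n \<notin> set ns \<longrightarrow> w n = v n) \<longrightarrow> holds S w p)"
proof (induction ns arbitrary: v)
  case Nil
  have "w = v" if "\<forall>n. w n = v n" for w using that by auto
  then show ?case by auto
next
  case (Cons a ns)
  have "(\<exists>d. \<forall>n. n \<notin> set ns \<longrightarrow> w n = (v(a := d)) n) \<longleftrightarrow> (\<forall>n. n \<notin> set (a # ns) \<longrightarrow> w n = v n)" for w
    by (auto intro!: exI[of _ "w a"])
  then show ?case by (simp add: Cons.IH del: fun_upd_apply) blast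
qed

text \<open>\<open>transfer_principle\<close> evaluates the nonstandard side only at assignments of
  standard values. The universal closure is insensitive to the assignment, so it transfers at a
  dummy one, and its instances reach every nonstandard \<open>w\<close>.\<close>

lemma transfer_open:
  assumes "transfer_principle V" "\<And>v. holds (\<lambda>R. R) v p"
  shows "holds (star_rel V) w p"
proof -
  let ?k = "variable_bound p"
  have "holds (\<lambda>R. R) (\<lambda>_. undefined) (foldr All [0..<?k] p)"
    using assms(2) by (simp add: holds_foldr_All)
  then have "holds (star_rel V) (star_el V \<circ> (\<lambda>_. undefined)) (foldr All [0..<?k] p)"
    using assms(1) unfolding transfer_principle_def by blast
  then have "holds (star_rel V) (\<lambda>n. if n < ?k then w n else star_el V undefined) p"
    unfolding holds_foldr_All by auto
  then show ?thesis by (subst holds_cong[of p w]) auto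
qed

definition Imp :: "'u formula \<Rightarrow> 'u formula \<Rightarrow> 'u formula" where
  "Imp p q = Neg (Conj p (Neg q))"

lemma holds_Imp [simp]: "holds S v (Imp p q) \<longleftrightarrow> (holds S v p \<longrightarrow> holds S v q)"
  by (simp add: Imp_def)

definition Iff :: "'u formula \<Rightarrow> 'u formula \<Rightarrow> 'u formula" where
  "Iff p q = Conj (Imp p q) (Imp q p)"

lemma holds_Iff [simp]: "holds S v (Iff p q) \<longleftrightarrow> (holds S v p \<longleftrightarrow> holds S v q)"
  unfolding Iff_def holds.simps holds_Imp by iprover

primrec Conjs :: "'u formula list \<Rightarrow> 'u formula" where
  "Conjs [] = Eq 0 0"
| "Conjs (p # ps) = Conj p (Conjs ps)"

lemma holds_Conjs [simp]: "holds S v (Conjs ps) \<longleftrightarrow> (\<forall>p\<in>set ps. holds S v p)"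
  by (induction ps) auto

section \<open>Boolean operations and graphs under the star map\<close>

lemma map_nth_append: "map ((!) (xs @ ys)) [0..<length xs] = xs"
  by (rule nth_equalityI) (auto simp: nth_append)

lemma map_nth_append2: "map ((!) (xs @ ys)) [length xs..<length xs + length ys] = ys"
  by (rule nth_equalityI) (auto simp: nth_append)

text \<open>The tuple itself is the assignment, through \<open>(!)\<close>; indices past its end do
  not occur in the formula. Together with the facts on complements, inclusion and
  \<open>UNIV\<close> this makes the relations whose extension contains \<open>ps\<close> an
  ultrafilter.\<close>

lemma star_rel_Int:
  assumes "transfer_principle V"
  shows "ps \<in> star_rel V (R \<inter> S) \<longleftrightarrow> ps \<in> star_rel V R \<and> ps \<in> star_rel V S"
proof -
  let ?n = "[0..<length ps]"
  have "holds (star_rel V) ((!) ps) 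
      (Iff (Rel (R \<inter> S) ?n) (Conj (Rel R ?n) (Rel S ?n)))"
    by (rule transfer_open[OF assms]) simp
  then show ?thesis by (simp add: map_nth)
qed

lemma star_rel_Compl:
  assumes "transfer_principle V"
  shows "ps \<in> star_rel V (- R) \<longleftrightarrow> ps \<notin> star_rel V R"
proof -
  let ?n = "[0..<length ps]"
  have "holds (star_rel V) ((!) ps) (Iff (Rel (- R) ?n) (Neg (Rel R ?n)))"
    by (rule transfer_open[OF assms]) simp
  then show ?thesis by (simp add: map_nth)
qed

lemma star_rel_mono:
  assumes "transfer_principle V" "R \<subseteq> S"
  shows "star_rel V R \<subseteq> star_rel V S"
proof
  fix ps assume "ps \<in> star_rel V R"
  moreover have "R \<inter> S = R" using assms(2) by blast
  ultimately show "ps \<in> star_rel V S" using star_rel_Int[OF assms(1), of ps R S] by simp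
qed

lemma star_rel_UNIV:
  assumes "transfer_principle V"
  shows "ps \<in> star_rel V UNIV"
proof -
  have "ps \<in> star_rel V (R \<union> - R)" for R
    using star_rel_Compl[OF assms, of ps R] subsetD[OF star_rel_mono[OF assms, of R "R \<union> - R"], of ps]
      subsetD[OF star_rel_mono[OF assms, of "- R" "R \<union> - R"], of ps] by auto
  then show ?thesis by simp
qed

lemma star_rel_functional:
  assumes "transfer_principle V"
    and fn: "\<And>xs y z. xs @ [y] \<in> R \<Longrightarrow> xs @ [z] \<in> R \<Longrightarrow> y = z"
    and "ps @ [p] \<in> star_rel V R" "ps @ [q] \<in> star_rel V R"
  shows "p = q"
proof -
  let ?k = "length ps"
  have "holds (star_rel V) ((!) (ps @ [p, q]))
     (Imp (Conj (Rel R ([0..<?k] @ [?k])) (Rel R ([0..<?k] @ [Suc ?k]))) (Eq ?k (Suc ?k)))"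
    by (rule transfer_open[OF assms(1)]) (auto dest: fn)
  then show ?thesis using assms(3,4) by (simp add: map_nth_append nth_append)
qed

lemma star_rel_total:
  assumes "transfer_principle V"
    and tot: "\<And>xs. length xs = length ps \<Longrightarrow> \<exists>y. xs @ [y] \<in> R"
  shows "\<exists>p. ps @ [p] \<in> star_rel V R"
proof -
  let ?k = "length ps"
  have m: "map (v(?k := d)) [0..<?k] = map v [0..<?k]" for v :: "nat \<Rightarrow> 'z" and d by auto
  have "holds (star_rel V) ((!) ps) (Neg (All ?k (Neg (Rel R ([0..<?k] @ [?k])))))"
    by (rule transfer_open[OF assms(1)]) (simp add: m tot)
  then show ?thesis by (simp add: m map_nth)
qed

text \<open>With the diagonal available as a relation, equality of nonstandard values becomes an
  instance of the clause \<open>los\<close>.\<close>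

lemma star_rel_Eq:
  assumes "transfer_principle V"
  shows "[p, q] \<in> star_rel V {[x, x] | x. True} \<longleftrightarrow> p = q"
proof -
  let ?R = "Rel {[x, x] | x. True} [0, 1]"
  have "holds (star_rel V) ((!) [p, q]) (Iff ?R (Eq 0 1))"
    by (rule transfer_open[OF assms(1)]) auto
  then show ?thesis by simp
qed

text \<open>This links \<open>star_el\<close> to \<open>star_rel\<close>. The assignment has to
  carry the standard value \<open>c\<close> itself, so \<open>transfer_principle\<close> is applied
  directly and not through \<open>transfer_open\<close>.\<close>

lemma star_rel_singleton:
  assumes "transfer_principle V"
  shows "[p] \<in> star_rel V {[c]} \<longleftrightarrow> p = star_el V c"
proof -
  have 1: "[star_el V c] \<in> star_rel V {[c]}"
  proof -
    have "holds (\<lambda>R. R) (\<lambda>_. c) (Rel {[c]} [0])" by simp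
    then have "holds (star_rel V) (star_el V \<circ> (\<lambda>_. c)) (Rel {[c]} [0])"
      using assms unfolding transfer_principle_def by blast
    then show ?thesis by simp
  qed
  moreover have "p = star_el V c" if "[p] \<in> star_rel V {[c]}"
    by (rule star_rel_functional[OF assms, where ps = "[]" and R = "{[c]}"]) (use that 1 in auto)
  ultimately show ?thesis by blast
qed

text \<open>
  The sets of standard tuples whose extension contains a fixed nonstandard tuple form an ultrafilter,
  and \<open>e f\<close> is the value at that tuple of the extension of \<open>f\<close>; the clause \<open>los\<close> is the theorem of Los.
\<close>

locale ultrapower =
  fixes V :: "('u, 'n) universe" and U :: "'u list filter" and e :: "('u list \<Rightarrow> 'u) \<Rightarrow> 'n"
  assumes los: "map e fs \<in> star_rel V R \<longleftrightarrow> eventually (\<lambda>s. map (\<lambda>f. f s) fs \<in> R) U"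
    and e_eq: "e f = e g \<longleftrightarrow> eventually (\<lambda>s. f s = g s) U"
    and e_const: "e (\<lambda>_. c) = star_el V c"
    and functional: "(\<And>xs y z. xs @ [y] \<in> R \<Longrightarrow> xs @ [z] \<in> R \<Longrightarrow> y = z) \<Longrightarrow>
      ps @ [p] \<in> star_rel V R \<Longrightarrow> ps @ [q] \<in> star_rel V R \<Longrightarrow> p = q"

text \<open>The ultrafilter is the type of \<open>ps\<close>: a property of standard tuples is large
  when the extension of its truth set contains \<open>ps\<close>. The coordinate projections then
  represent the entries of \<open>ps\<close>.\<close>

theorem ultrapower_exists:
  fixes V :: "('u, 'n) universe"
  assumes tp: "transfer_principle V"
  obtains U e where "ultrapower V U e" "\<And>i. i < length ps \<Longrightarrow> ps ! i = e (\<lambda>s. s ! i)"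
proof -
  define k where "k = length ps"
  define U where "U = Abs_filter (\<lambda>P. ps \<in> star_rel V {s. P s})"
  have "is_filter (\<lambda>P. ps \<in> star_rel V {s. P s})"
  proof
    show "ps \<in> star_rel V {s. True}" using star_rel_UNIV[OF tp] by simp
  next
    fix P Q assume "ps \<in> star_rel V {s. P s}" "ps \<in> star_rel V {s. Q s}"
    then show "ps \<in> star_rel V {s. P s \<and> Q s}"
      using star_rel_Int[OF tp, of ps "{s. P s}" "{s. Q s}"] by (simp add: Int_def)
  next
    fix P Q assume "\<forall>s. P s \<longrightarrow> Q s" "ps \<in> star_rel V {s. P s}"
    then show "ps \<in> star_rel V {s. Q s}"
      using star_rel_mono[OF tp, of "{s. P s}" "{s. Q s}"] by blast
  qed
  then have ev: "eventually P U \<longleftrightarrow> ps \<in> star_rel V {s. P s}" for P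
    unfolding U_def by (rule eventually_Abs_filter)
  \<comment> \<open>The graph of \<open>f\<close> as a relation, the value being appended to the
    argument tuple; totality and functionality transfer, so exactly one nonstandard value belongs to
    \<open>ps\<close>.\<close>
  define G :: "('u list \<Rightarrow> 'u) \<Rightarrow> 'u list set" where "G f = {s @ [f s] | s. True}" for f
  have G_iff: "s @ [y] \<in> G f \<longleftrightarrow> y = f s" for s y f by (auto simp: G_def)
  define e where "e f = (THE y. ps @ [y] \<in> star_rel V (G f))" for f
  have G_fun: "p = q" if "ps @ [p] \<in> star_rel V (G f)" "ps @ [q] \<in> star_rel V (G f)" for p q f
    using star_rel_functional[OF tp _ that] by (simp add: G_iff)
  have e_in: "ps @ [e f] \<in> star_rel V (G f)" for f
  proof -
    have "\<exists>!y. ps @ [y] \<in> star_rel V (G f)"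
    proof (rule ex_ex1I)
      show "\<exists>y. ps @ [y] \<in> star_rel V (G f)"
        by (rule star_rel_total[OF tp]) (simp add: G_iff)
    qed (rule G_fun)
    then show ?thesis unfolding e_def by (rule theI')
  qed
  have los: "map e fs \<in> star_rel V R \<longleftrightarrow> eventually (\<lambda>s. map (\<lambda>f. f s) fs \<in> R) U" for fs R
  proof -
    define m where "m = length fs"
    let ?Q = "{s. map (\<lambda>f. f s) fs \<in> R}"
    let ?p = "Rel R [k..<k + m]" and ?q = "Rel ?Q [0..<k]"
    \<comment> \<open>The graph relations force the variables \<open>k + j\<close> to be the values
      of \<open>fs ! j\<close> at the first \<open>k\<close> variables. Under that premise
      \<open>R\<close> at the values is equivalent to a property of the first \<open>k\<close>
      variables alone, which is what the ultrafilter measures.\<close>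
    have "holds (star_rel V) ((!) (ps @ map e fs))
      (Imp (Conjs (map (\<lambda>j. Rel (G (fs ! j)) ([0..<k] @ [k + j])) [0..<m]))
        (Iff ?p ?q))"
    proof (rule transfer_open[OF tp])
      fix v
      have "map v [k..<k + m] = map (\<lambda>f. f (map v [0..<k])) fs"
        if "\<And>j. j < m \<Longrightarrow> v (k + j) = (fs ! j) (map v [0..<k])"
        by (rule nth_equalityI) (simp_all add: m_def that)
      then show "holds (\<lambda>R. R) v
        (Imp (Conjs (map (\<lambda>j. Rel (G (fs ! j)) ([0..<k] @ [k + j])) [0..<m]))
          (Iff ?p ?q))"
        by (simp add: G_iff atLeast0LessThan)
    qed
    then have "(\<forall>j<m. ps @ [(ps @ map e fs) ! (k + j)] \<in> star_rel V (G (fs ! j))) \<Longrightarrow>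
      map e fs \<in> star_rel V R \<longleftrightarrow> ps \<in> star_rel V ?Q"
      using map_nth_append[of ps "map e fs"] map_nth_append2[of ps "map e fs"]
      by (simp add: atLeast0LessThan k_def m_def nth_append)
    moreover have "(ps @ map e fs) ! (k + j) = e (fs ! j)" if "j < m" for j
      using that by (simp add: nth_append k_def m_def)
    ultimately have "map e fs \<in> star_rel V R \<longleftrightarrow> ps \<in> star_rel V ?Q"
      by (simp add: e_in)
    then show ?thesis by (simp only: ev)
  qed
  show thesis
  proof
    show "ultrapower V U e"
    proof
      fix f g
      show "e f = e g \<longleftrightarrow> eventually (\<lambda>s. f s = g s) U"
        using los[of "[f, g]" "{[x, x] | x. True}"] star_rel_Eq[OF tp, of "e f" "e g"]
        by (simp add: eq_commute)
    next
      fix c show "e (\<lambda>_. c) = star_el V c"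
        using los[of "[\<lambda>_. c]" "{[c]}"] star_rel_singleton[OF tp, of "e (\<lambda>_. c)" c] by simp
    qed (rule los, rule star_rel_functional[OF tp])
  next
    fix i assume "i < length ps"
    then have ik: "i < k" by (simp add: k_def)
    have "holds (star_rel V) ((!) (ps @ [e (\<lambda>s. s ! i)]))
      (Imp (Rel (G (\<lambda>s. s ! i)) ([0..<k] @ [k])) (Eq i k))"
      by (rule transfer_open[OF tp]) (simp add: G_iff ik)
    moreover have "map ((!) (ps @ [e (\<lambda>s. s ! i)])) [0..<k] = ps"
      unfolding k_def by (rule map_nth_append)
    ultimately show "ps ! i = e (\<lambda>s. s ! i)"
      using e_in[of "\<lambda>s. s ! i"] ik by (simp add: nth_append k_def)
  qed
qed

section \<open>Square roots and sums of squares in C*-algebras\<close>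

text \<open>The iterates of \<open>w \<mapsto> (t + w\<^sup>2) / 2\<close> for the scalar \<open>t = 1\<close>; they dominate those for any \<open>t\<close> of norm at most 1.\<close>

primrec sqrt_majorant :: "nat \<Rightarrow> real" where
  "sqrt_majorant 0 = 0"
| "sqrt_majorant (Suc n) = (1 + (sqrt_majorant n)\<^sup>2) / 2"

lemma sqrt_majorant_bounds: "0 \<le> sqrt_majorant n \<and> sqrt_majorant n \<le> 1"
  by (induction n) (auto simp: power_le_one)

text \<open>Each increment is (b - 1)^2 / 2 for b the current term, so the sequence increases, and
  it is bounded by 1.\<close>

lemma Cauchy_sqrt_majorant: "Cauchy sqrt_majorant"
proof -
  have "sqrt_majorant n \<le> sqrt_majorant (Suc n)" for n
    using zero_le_power2[of "sqrt_majorant n - 1"] by (simp add: power2_eq_square algebra_simps)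
  then have "incseq sqrt_majorant" by (rule incseq_SucI)
  moreover have "Bseq sqrt_majorant"
    by (rule BseqI'[of _ 1]) (simp add: sqrt_majorant_bounds)
  ultimately show ?thesis
    by (intro convergent_Cauchy Bseq_monoseq_convergent) (auto simp: monoseq_iff)
qed

section \<open>Scalars, adjoints, norms and the square root iteration\<close>

context cstar_algebra
begin

lemma scalar_closed [simp]: "x \<in> carrier A \<Longrightarrow> c \<odot> x \<in> carrier A"
  using smult_closed[of c x] by (simp add: complex_ring_def)

lemma scalar_add_left: "x \<in> carrier A \<Longrightarrow> (c + d) \<odot> x = c \<odot> x \<oplus> d \<odot> x"
  using smult_l_distr[of c d x] by (simp add: complex_ring_def)

lemma scalar_add_right:
  "x \<in> carrier A \<Longrightarrow> y \<in> carrier A \<Longrightarrow> c \<odot> (x \<oplus> y) = c \<odot> x \<oplus> c \<odot> y"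
  using smult_r_distr[of c x y] by (simp add: complex_ring_def)

lemma scalar_scalar [simp]: "x \<in> carrier A \<Longrightarrow> c \<odot> (d \<odot> x) = (c * d) \<odot> x"
  using smult_assoc1[of c d x] by (simp add: complex_ring_def)

lemma scalar_one [simp]: "x \<in> carrier A \<Longrightarrow> 1 \<odot> x = x"
  using smult_one[of x] by (simp add: complex_ring_def)

lemma scalar_minus_one: "x \<in> carrier A \<Longrightarrow> (- 1) \<odot> x = \<ominus> x"
  using scalar_add_left[of x 1 "-1"] smult_l_null[of x] 
  by (metis add.right_inverse complex_ring_def minus_equality a_comm ring_record_simps(11) scalar_closed scalar_one)




lemma scalar_diff_right:
  "x \<in> carrier A \<Longrightarrow> y \<in> carrier A \<Longrightarrow> c \<odot> (x \<ominus> y) = c \<odot> x \<ominus> c \<odot> y"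
  by (simp add: minus_eq scalar_add_right flip: scalar_minus_one)

lemma adj_minus: "x \<in> carrier A \<Longrightarrow> adj A (\<ominus> x) = \<ominus> adj A x"
  using adj_smult[of x "-1"] by (simp add: scalar_minus_one adj_closed)

lemma adj_diff:
  "x \<in> carrier A \<Longrightarrow> y \<in> carrier A \<Longrightarrow> adj A (x \<ominus> y) = adj A x \<ominus> adj A y"
  by (simp add: minus_eq adj_add adj_minus adj_closed)

lemma adj_one: "adj A \<one> = \<one>"
  using adj_mult[of "adj A \<one>" \<one>] by (simp add: adj_closed adj_adj)

lemma nrm_zero [simp]: "nrm A \<zero> = 0"
  by (simp add: nrm_eq_0)

lemma nrm_minus: "x \<in> carrier A \<Longrightarrow> nrm A (\<ominus> x) = nrm A x"
  using nrm_smult[of x "-1"] by (simp add: scalar_minus_one)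

lemma nrm_diff_commute:
  assumes "x \<in> carrier A" "y \<in> carrier A"
  shows "nrm A (x \<ominus> y) = nrm A (y \<ominus> x)"
proof -
  have "x \<ominus> y = \<ominus> (y \<ominus> x)" using assms by algebra
  then show ?thesis using assms by (simp add: nrm_minus)
qed

lemma nrm_diff:
  "x \<in> carrier A \<Longrightarrow> y \<in> carrier A \<Longrightarrow> nrm A (x \<ominus> y) \<le> nrm A x + nrm A y"
  using nrm_add[of x "\<ominus> y"] by (simp add: minus_eq nrm_minus)

lemma nrm_triangle:
  assumes "x \<in> carrier A" "y \<in> carrier A" "z \<in> carrier A"
  shows "nrm A (x \<ominus> z) \<le> nrm A (x \<ominus> y) + nrm A (y \<ominus> z)"
proof -
  have "x \<ominus> z = (x \<ominus> y) \<oplus> (y \<ominus> z)" using assms by algebra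
  then show ?thesis using assms nrm_add[of "x \<ominus> y" "y \<ominus> z"] by simp
qed

text \<open>The C*-identity and submultiplicativity give (norm y)^2 \<le> norm (adj y) * norm y.
  Cancelling norm y yields one inequality; applying it to the adjoint yields the other.\<close>

lemma nrm_adj:
  assumes "x \<in> carrier A"
  shows "nrm A (adj A x) = nrm A x"
proof -
  have *: "nrm A y \<le> nrm A (adj A y)" if "y \<in> carrier A" for y
  proof (cases "nrm A y = 0")
    case False
    then have "0 < nrm A y" using nrm_nonneg[OF that] by simp
    moreover have "nrm A y * nrm A y \<le> nrm A (adj A y) * nrm A y"
      using nrm_mult[of "adj A y" y] that by (simp add: cstar_identity adj_closed power2_eq_square)
    ultimately show ?thesis by simp
  qed (simp add: nrm_nonneg adj_closed that)
  show ?thesis using *[of x] *[of "adj A x"] assms by (simp add: adj_adj adj_closed)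
qed

lemma nrm_one_le: "nrm A \<one> \<le> 1"
proof -
  have "nrm A \<one> * nrm A \<one> = nrm A \<one>"
    using cstar_identity[of \<one>] by (simp add: adj_one power2_eq_square)
  then show ?thesis by (cases "nrm A \<one> = 0") auto
qed

lemma self_adjointD:
  "x \<in> self_adjoint A \<Longrightarrow> x \<in> carrier A" "x \<in> self_adjoint A \<Longrightarrow> adj A x = x"
  by (auto simp: self_adjoint_def)

lemma self_adjoint_square: "x \<in> self_adjoint A \<Longrightarrow> x \<otimes> x \<in> self_adjoint A"
  by (simp add: self_adjoint_def adj_mult)

lemma self_adjoint_real_scalar: "x \<in> self_adjoint A \<Longrightarrow> complex_of_real r \<odot> x \<in> self_adjoint A"
  by (simp add: self_adjoint_def adj_smult)

lemma self_adjoint_add: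
  "x \<in> self_adjoint A \<Longrightarrow> y \<in> self_adjoint A \<Longrightarrow> x \<oplus> y \<in> self_adjoint A"
  by (simp add: self_adjoint_def adj_add)

lemma self_adjoint_diff:
  "x \<in> self_adjoint A \<Longrightarrow> y \<in> self_adjoint A \<Longrightarrow> x \<ominus> y \<in> self_adjoint A"
  by (simp add: self_adjoint_def adj_diff)

lemma self_adjoint_one: "\<one> \<in> self_adjoint A"
  by (simp add: self_adjoint_def adj_one)

lemma nrm_square:
  "x \<in> self_adjoint A \<Longrightarrow> nrm A (x \<otimes> x) = (nrm A x)\<^sup>2"
  using cstar_identity[of x] by (simp add: self_adjoint_def)

text \<open>For a fixed point w the element 1 - w squares to 1 - t. Starting from zero, every
  iterate is a real polynomial in \<open>t\<close>, which is the source of self-adjointness and of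
  all commutation below.\<close>

primrec sqrt_iterate :: "'e \<Rightarrow> nat \<Rightarrow> 'e" where
  "sqrt_iterate t 0 = \<zero>"
| "sqrt_iterate t (Suc n) = (1/2) \<odot> (t \<oplus> sqrt_iterate t n \<otimes> sqrt_iterate t n)"

lemma sqrt_iterate_closed [simp]: "t \<in> carrier A \<Longrightarrow> sqrt_iterate t n \<in> carrier A"
  by (induction n) auto

lemma sqrt_iterate_self_adjoint: "t \<in> self_adjoint A \<Longrightarrow> sqrt_iterate t n \<in> self_adjoint A"
proof (induction n)
  case 0
  have "adj A \<zero> = \<zero>" using adj_minus[of \<zero>] adj_diff[of \<one> \<one>]
    by (simp add: adj_one minus_eq r_neg)
  then show ?case by (simp add: self_adjoint_def)
next
  case (Suc n)
  then show ?case
    using self_adjoint_real_scalar[of "t \<oplus> sqrt_iterate t n \<otimes> sqrt_iterate t n" "1/2"]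
    by (simp add: self_adjoint_add self_adjoint_square)
qed

text \<open>Stated for any \<open>x\<close> commuting with \<open>t\<close>, so that it serves
  twice: with \<open>x\<close> an iterate, to make consecutive iterates commute, and with a general
  \<open>x\<close>, to pass commutation to the limit.\<close>

lemma sqrt_iterate_commute:
  assumes "t \<in> carrier A" "x \<in> carrier A" "x \<otimes> t = t \<otimes> x"
  shows "x \<otimes> sqrt_iterate t n = sqrt_iterate t n \<otimes> x"
proof (induction n)
  case (Suc n)
  let ?w = "sqrt_iterate t n"
  have w: "?w \<in> carrier A" using assms by simp
  have "x \<otimes> (?w \<otimes> ?w) = ?w \<otimes> (x \<otimes> ?w)"
    using m_assoc[OF assms(2) w w] m_assoc[OF w assms(2) w] by (simp add: Suc)
  also have "\<dots> = (?w \<otimes> ?w) \<otimes> x" using m_assoc[OF w w assms(2)] by (simp add: Suc)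
  finally show ?case
    using assms w by (simp add: smult_mult_left smult_mult_right l_distr r_distr)
qed (use assms in simp)

lemma nrm_sqrt_iterate:
  assumes "t \<in> carrier A" "nrm A t \<le> 1"
  shows "nrm A (sqrt_iterate t n) \<le> sqrt_majorant n"
proof (induction n)
  case (Suc n)
  let ?w = "sqrt_iterate t n"
  have w: "?w \<in> carrier A" using assms by simp
  have "nrm A (?w \<otimes> ?w) \<le> nrm A ?w * nrm A ?w" using w by (simp add: nrm_mult)
  also have "\<dots> \<le> sqrt_majorant n * sqrt_majorant n"
    using Suc w by (intro mult_mono) (auto simp: nrm_nonneg sqrt_majorant_bounds)
  finally show ?case
    using assms w nrm_add[of t "?w \<otimes> ?w"] by (simp add: nrm_smult power2_eq_square norm_divide)
qed simp

text \<open>The next difference is half of v^2 - w^2, which factors as (v - w)(v + w) because the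
  iterates v and w commute. The increments of the majorant satisfy the same recursion with equality,
  so the bounds for the two factors multiply to exactly the next bound.\<close>

lemma nrm_sqrt_iterate_Suc_diff:
  assumes "t \<in> carrier A" "nrm A t \<le> 1"
  shows "nrm A (sqrt_iterate t (Suc n) \<ominus> sqrt_iterate t n) \<le> sqrt_majorant (Suc n) - sqrt_majorant n"
proof (induction n)
  case 0
  then show ?case using assms by (simp add: minus_eq nrm_smult norm_divide)
next
  case (Suc n)
  let ?w = "sqrt_iterate t n" and ?v = "sqrt_iterate t (Suc n)"
  have w: "?w \<in> carrier A" "?v \<in> carrier A" by (rule sqrt_iterate_closed[OF assms(1)])+
  have wt: "?w \<otimes> t = t \<otimes> ?w"
    by (rule sqrt_iterate_commute[OF assms(1) assms(1) refl, symmetric])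
  have comm: "?w \<otimes> ?v = ?v \<otimes> ?w"
    by (rule sqrt_iterate_commute[OF assms(1) w(1) wt])
  have alg: "(t \<oplus> v \<otimes> v) \<ominus> (t \<oplus> w \<otimes> w) = (v \<ominus> w) \<otimes> (v \<oplus> w)"
    if "v \<in> carrier A" "w \<in> carrier A" "w \<otimes> v = v \<otimes> w" for v w
  proof -
    \<comment> \<open>The ring is noncommutative, so the identity is first stated with the
      commutator as a correction term; that term vanishes by the hypothesis on v and w.\<close>
    have "(t \<oplus> v \<otimes> v) \<ominus> (t \<oplus> w \<otimes> w) = (v \<ominus> w) \<otimes> (v \<oplus> w) \<oplus> (w \<otimes> v \<ominus> v \<otimes> w)"
      using that(1,2) assms(1) by algebra
    then show ?thesis using that by simp
  qed
  have "sqrt_iterate t (Suc (Suc n)) \<ominus> ?v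
      = (1/2) \<odot> (t \<oplus> ?v \<otimes> ?v) \<ominus> (1/2) \<odot> (t \<oplus> ?w \<otimes> ?w)"
    by (simp only: sqrt_iterate.simps)
  also have "\<dots> = (1/2) \<odot> ((t \<oplus> ?v \<otimes> ?v) \<ominus> (t \<oplus> ?w \<otimes> ?w))"
    by (rule scalar_diff_right[symmetric]) (use assms w in \<open>simp_all del: sqrt_iterate.simps\<close>)
  also have "\<dots> = (1/2) \<odot> ((?v \<ominus> ?w) \<otimes> (?v \<oplus> ?w))"
    by (simp only: alg[OF w(2,1) comm])
  finally have eq: "sqrt_iterate t (Suc (Suc n)) \<ominus> ?v = (1/2) \<odot> ((?v \<ominus> ?w) \<otimes> (?v \<oplus> ?w))" .
  have "nrm A (?v \<oplus> ?w) \<le> sqrt_majorant (Suc n) + sqrt_majorant n"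
    using nrm_add[OF w(2,1)] nrm_sqrt_iterate[OF assms, of n] nrm_sqrt_iterate[OF assms, of "Suc n"]
    by linarith
  then have "nrm A (?v \<ominus> ?w) * nrm A (?v \<oplus> ?w)
      \<le> (sqrt_majorant (Suc n) - sqrt_majorant n) * (sqrt_majorant (Suc n) + sqrt_majorant n)"
    by (intro mult_mono Suc.IH order_trans[OF nrm_nonneg Suc.IH] nrm_nonneg)
      (use w in \<open>auto simp del: sqrt_iterate.simps\<close>)
  moreover have "nrm A ((?v \<ominus> ?w) \<otimes> (?v \<oplus> ?w)) \<le> nrm A (?v \<ominus> ?w) * nrm A (?v \<oplus> ?w)"
    using w by (intro nrm_mult) (simp_all del: sqrt_iterate.simps)
  moreover have "nrm A (sqrt_iterate t (Suc (Suc n)) \<ominus> ?v) = nrm A ((?v \<ominus> ?w) \<otimes> (?v \<oplus> ?w)) / 2"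
    unfolding eq using w by (subst nrm_smult) (simp_all del: sqrt_iterate.simps add: norm_divide)
  moreover have "(a - b) * (a + b) / 2 = (1 + a\<^sup>2) / 2 - (1 + b\<^sup>2) / 2" for a b :: real
    by (simp add: power2_eq_square field_simps)
  then have "(sqrt_majorant (Suc n) - sqrt_majorant n) * (sqrt_majorant (Suc n) + sqrt_majorant n) / 2
      = sqrt_majorant (Suc (Suc n)) - sqrt_majorant (Suc n)"
    by (simp only: sqrt_majorant.simps(2))
  ultimately show ?case by linarith
qed

lemma nrm_sqrt_iterate_diff:
  assumes "t \<in> carrier A" "nrm A t \<le> 1" "n \<le> m"
  shows "nrm A (sqrt_iterate t m \<ominus> sqrt_iterate t n) \<le> sqrt_majorant m - sqrt_majorant n"
  using assms(3)
proof (induction rule: dec_induct)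
  case base
  then show ?case using assms by (simp add: minus_eq r_neg)
next
  case (step m)
  then show ?case
    using nrm_triangle[of "sqrt_iterate t (Suc m)" "sqrt_iterate t m" "sqrt_iterate t n"]
      nrm_sqrt_iterate_Suc_diff[OF assms(1,2), of m] assms(1)
    by (simp del: sqrt_iterate.simps sqrt_majorant.simps)
qed

lemma sqrt_iterate_limit:
  assumes "t \<in> carrier A" "nrm A t \<le> 1"
  obtains w where "w \<in> carrier A" "(\<lambda>n. nrm A (sqrt_iterate t n \<ominus> w)) \<longlonglongrightarrow> 0"
proof -
  have "\<exists>N. \<forall>m\<ge>N. \<forall>n\<ge>N. nrm A (sqrt_iterate t m \<ominus> sqrt_iterate t n) < \<epsilon>" if "\<epsilon> > 0" for \<epsilon>
  proof -
    obtain N where N: "\<forall>m\<ge>N. \<forall>n\<ge>N. norm (sqrt_majorant m - sqrt_majorant n) < \<epsilon>"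
      using CauchyD[OF Cauchy_sqrt_majorant \<open>\<epsilon> > 0\<close>] by blast
    have "nrm A (sqrt_iterate t m \<ominus> sqrt_iterate t n) < \<epsilon>" if "m \<ge> N" "n \<ge> N" for m n
    proof -
      have *: "\<bar>sqrt_majorant m - sqrt_majorant n\<bar> < \<epsilon>" using N that by auto
      show ?thesis
      proof (cases "n \<le> m")
        case True
        then show ?thesis using nrm_sqrt_iterate_diff[OF assms True] * by linarith
      next
        case False
        then have "nrm A (sqrt_iterate t n \<ominus> sqrt_iterate t m) < \<epsilon>"
          using nrm_sqrt_iterate_diff[OF assms, of m n] * by linarith
        then show ?thesis
          using nrm_diff_commute[of "sqrt_iterate t m" "sqrt_iterate t n"] assms(1) by simp
      qed
    qed
    then show ?thesis by blast
  qed
  then show thesis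
    using complete[of "sqrt_iterate t"] assms(1) that by auto
qed

lemma eq_if_nrm_diff_le:
  assumes "x \<in> carrier A" "y \<in> carrier A" "d \<longlonglongrightarrow> 0" "\<And>n. nrm A (x \<ominus> y) \<le> d n"
  shows "x = y"
proof -
  have "nrm A (x \<ominus> y) \<le> 0" by (rule LIMSEQ_le_const[OF assms(3)]) (use assms(4) in blast)
  then have "x \<ominus> y = \<zero>" using nrm_nonneg[of "x \<ominus> y"] nrm_eq_0[of "x \<ominus> y"] assms by auto
  then show ?thesis using assms by simp
qed

text \<open>The root is 1 - w for the limit w of the iterates, whose self-adjointness, commutation
  and recursion pass to the limit. The commutation clause is what later lets a root of 1 - x^2
  commute with x.\<close>

lemma sqrt_one_minus:
  assumes t: "t \<in> self_adjoint A" "nrm A t \<le> 1"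
  obtains s where "s \<in> self_adjoint A" "s \<otimes> s = \<one> \<ominus> t"
    "\<And>x. x \<in> carrier A \<Longrightarrow> x \<otimes> t = t \<otimes> x \<Longrightarrow> x \<otimes> s = s \<otimes> x"
proof -
  have tA: "t \<in> carrier A" using t by (simp add: self_adjoint_def)
  define X where "X = sqrt_iterate t"
  obtain w where w: "w \<in> carrier A" and lim: "(\<lambda>n. nrm A (X n \<ominus> w)) \<longlonglongrightarrow> 0"
    using sqrt_iterate_limit[OF tA t(2)] unfolding X_def by blast
  have X: "X n \<in> carrier A" for n using tA by (simp add: X_def)
  have "adj A w = w"
  proof (rule eq_if_nrm_diff_le)
    show "(\<lambda>n. nrm A (X n \<ominus> w) + nrm A (X n \<ominus> w)) \<longlonglongrightarrow> 0"
      using tendsto_add[OF lim lim] by simp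
    fix n
    have "adj A (X n) = X n" using sqrt_iterate_self_adjoint[OF t(1)] by (simp add: X_def self_adjoint_def)
    then have "nrm A (adj A w \<ominus> X n) = nrm A (X n \<ominus> w)"
      using nrm_adj[of "w \<ominus> X n"] nrm_diff_commute[OF w X, of n] w X by (simp add: adj_diff)
    then show "nrm A (adj A w \<ominus> w) \<le> nrm A (X n \<ominus> w) + nrm A (X n \<ominus> w)"
      using nrm_triangle[of "adj A w" "X n" w] w X by (simp add: adj_closed)
  qed (use w in \<open>simp_all add: adj_closed\<close>)
  then have w_sa: "w \<in> self_adjoint A" using w by (simp add: self_adjoint_def)
  have commute: "x \<otimes> w = w \<otimes> x" if x: "x \<in> carrier A" "x \<otimes> t = t \<otimes> x" for x
  proof (rule eq_if_nrm_diff_le)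
    show "(\<lambda>n. 2 * nrm A x * nrm A (X n \<ominus> w)) \<longlonglongrightarrow> 0"
      using tendsto_mult_left[OF lim, of "2 * nrm A x"] by simp
    fix n
    have c: "x \<otimes> X n = X n \<otimes> x" using sqrt_iterate_commute[OF tA x] by (simp add: X_def)
    \<comment> \<open>Adding the commutator of x with \<open>X n\<close>, which is zero, expresses
      the commutator with w through X n - w only.\<close>
    have "x \<otimes> w \<ominus> w \<otimes> x = (X n \<ominus> w) \<otimes> x \<ominus> x \<otimes> (X n \<ominus> w) \<oplus> (x \<otimes> X n \<ominus> X n \<otimes> x)"
      using w X[of n] x(1) by algebra
    then have "x \<otimes> w \<ominus> w \<otimes> x = (X n \<ominus> w) \<otimes> x \<ominus> x \<otimes> (X n \<ominus> w)"
      using c w X[of n] x(1) by simp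
    then show "nrm A (x \<otimes> w \<ominus> w \<otimes> x) \<le> 2 * nrm A x * nrm A (X n \<ominus> w)"
      using nrm_diff[of "(X n \<ominus> w) \<otimes> x" "x \<otimes> (X n \<ominus> w)"] nrm_mult[of "X n \<ominus> w" x]
        nrm_mult[of x "X n \<ominus> w"] w X[of n] x(1) by (simp add: algebra_simps)
  qed (use w x in simp_all)
  have fixed: "w = (1/2) \<odot> (t \<oplus> w \<otimes> w)"
  proof (rule eq_if_nrm_diff_le)
    \<comment> \<open>The point w is compared with its image through X (n + 1). Since x^2 - w^2 = x
      (x - w) + (x - w) w and norm (X n) \<le> 1, the iteration map contributes the factor (1 + norm
      w) / 2.\<close>
    show "(\<lambda>n. nrm A (X (Suc n) \<ominus> w) + (1 + nrm A w) / 2 * nrm A (X n \<ominus> w)) \<longlonglongrightarrow> 0"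
      using tendsto_add[OF LIMSEQ_Suc[OF lim] tendsto_mult_left[OF lim, of "(1 + nrm A w) / 2"]] by simp
    fix n
    have le1: "nrm A (X n) \<le> 1"
      using nrm_sqrt_iterate[OF tA t(2), of n] sqrt_majorant_bounds[of n] by (simp add: X_def)
    have XS: "X (Suc n) = (1/2) \<odot> (t \<oplus> X n \<otimes> X n)" by (simp add: X_def)
    have alg: "(t \<oplus> x \<otimes> x) \<ominus> (t \<oplus> w \<otimes> w) = x \<otimes> (x \<ominus> w) \<oplus> (x \<ominus> w) \<otimes> w"
      if "x \<in> carrier A" for x
      using that w tA by algebra
    have "X (Suc n) \<ominus> (1/2) \<odot> (t \<oplus> w \<otimes> w) = (1/2) \<odot> (X n \<otimes> (X n \<ominus> w) \<oplus> (X n \<ominus> w) \<otimes> w)"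
      unfolding alg[OF X, symmetric] XS using X[of n] w tA by (intro scalar_diff_right[symmetric]) auto
    moreover have "nrm A (X n \<otimes> (X n \<ominus> w) \<oplus> (X n \<ominus> w) \<otimes> w)
        \<le> nrm A (X n \<otimes> (X n \<ominus> w)) + nrm A ((X n \<ominus> w) \<otimes> w)"
      using X[of n] w by (intro nrm_add) auto
    moreover have "nrm A (X n \<otimes> (X n \<ominus> w)) \<le> nrm A (X n \<ominus> w)"
      using nrm_mult[of "X n" "X n \<ominus> w"] mult_right_mono[OF le1, of "nrm A (X n \<ominus> w)"]
        nrm_nonneg[of "X n \<ominus> w"] X[of n] w by simp
    moreover have "nrm A ((X n \<ominus> w) \<otimes> w) \<le> nrm A (X n \<ominus> w) * nrm A w"
      using X[of n] w by (intro nrm_mult) auto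
    ultimately have "nrm A (X (Suc n) \<ominus> (1/2) \<odot> (t \<oplus> w \<otimes> w)) \<le> (1 + nrm A w) / 2 * nrm A (X n \<ominus> w)"
      using X[of n] w by (simp add: nrm_smult norm_divide algebra_simps)
    then show "nrm A (w \<ominus> (1/2) \<odot> (t \<oplus> w \<otimes> w))
        \<le> nrm A (X (Suc n) \<ominus> w) + (1 + nrm A w) / 2 * nrm A (X n \<ominus> w)"
      using nrm_triangle[of w "X (Suc n)" "(1/2) \<odot> (t \<oplus> w \<otimes> w)"] nrm_diff_commute[OF w X, of "Suc n"]
        X[of "Suc n"] w tA by simp
  qed (use w tA in simp_all)
  have "2 \<odot> w = t \<oplus> w \<otimes> w"
    by (subst fixed) (use w tA in simp)
  then have ww: "w \<oplus> w = t \<oplus> w \<otimes> w"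
    using scalar_add_left[OF w, of 1 1] w by simp
  show thesis
  proof (rule that)
    show "\<one> \<ominus> w \<in> self_adjoint A" by (intro self_adjoint_diff self_adjoint_one w_sa)
    \<comment> \<open>At u = 1 the second bracket is t + w^2 - (w + w), which is zero by
      \<open>ww\<close>.\<close>
    have "(u \<ominus> w) \<otimes> (u \<ominus> w) = (u \<otimes> u \<ominus> t) \<oplus> ((t \<oplus> w \<otimes> w) \<ominus> (w \<otimes> u \<oplus> u \<otimes> w))"
      if "u \<in> carrier A" for u
      using that w tA by algebra
    from this[OF one_closed] show "(\<one> \<ominus> w) \<otimes> (\<one> \<ominus> w) = \<one> \<ominus> t"
      using w tA by (simp add: ww[symmetric])
  next
    fix x assume x: "x \<in> carrier A" "x \<otimes> t = t \<otimes> x"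
    show "x \<otimes> (\<one> \<ominus> w) = (\<one> \<ominus> w) \<otimes> x"
      using commute[OF x] x(1) w by (simp add: minus_eq l_distr r_distr r_minus l_minus)
  qed
qed

text \<open>
  With \<open>s\<^sup>2 = 1 - x\<^sup>2\<close> commuting with \<open>x\<close>, the element \<open>x + \<i> s\<close> is unitary, and \<open>s\<close> is its imaginary part.
\<close>

lemma nrm_one_minus_square:
  assumes x: "x \<in> self_adjoint A" "nrm A x \<le> 1"
  shows "nrm A (\<one> \<ominus> x \<otimes> x) \<le> 1"
proof -
  have xA: "x \<in> carrier A" and adx: "adj A x = x" using x by (auto simp: self_adjoint_def)
  have "nrm A (x \<otimes> x) \<le> 1"
    using x by (simp add: nrm_square power_le_one nrm_nonneg xA)
  then obtain s where s: "s \<in> self_adjoint A" "s \<otimes> s = \<one> \<ominus> x \<otimes> x"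
    and comm: "\<And>y. y \<in> carrier A \<Longrightarrow> y \<otimes> (x \<otimes> x) = (x \<otimes> x) \<otimes> y \<Longrightarrow> y \<otimes> s = s \<otimes> y"
    using sqrt_one_minus[OF self_adjoint_square[OF x(1)]] by blast
  have xs: "x \<otimes> s = s \<otimes> x" using comm[OF xA] xA by (simp add: m_assoc)
  have sA: "s \<in> carrier A" and ads: "adj A s = s" using s by (auto simp: self_adjoint_def)
  define u where "u = x \<oplus> \<i> \<odot> s"
  have uA: "u \<in> carrier A" using xA sA by (simp add: u_def)
  have adu: "adj A u = x \<oplus> (- \<i>) \<odot> s" using xA sA by (simp add: u_def adj_add adj_smult adx ads)
  have "adj A u \<otimes> u = x \<otimes> x \<oplus> \<i> \<odot> (x \<otimes> s) \<oplus> ((- \<i>) \<odot> (s \<otimes> x) \<oplus> s \<otimes> s)"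
    using xA sA unfolding adu unfolding u_def
    by (simp add: l_distr r_distr smult_mult_left smult_mult_right a_ac scalar_add_right)
  also have "(- \<i>) \<odot> (s \<otimes> x) = \<ominus> (\<i> \<odot> (x \<otimes> s))"
    using xA sA by (simp add: xs flip: scalar_minus_one)
  also have "x \<otimes> x \<oplus> \<i> \<odot> (x \<otimes> s) \<oplus> (\<ominus> (\<i> \<odot> (x \<otimes> s)) \<oplus> s \<otimes> s) = x \<otimes> x \<oplus> s \<otimes> s"
    using xA sA by (simp add: a_assoc r_neg2)
  also have "\<dots> = \<one>" unfolding s(2) using xA by algebra
  finally have "(nrm A u)\<^sup>2 \<le> 1" using cstar_identity[OF uA] nrm_one_le by simp
  then have nu: "nrm A u \<le> 1" using power2_le_imp_le[of "nrm A u" 1] by simp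
  have "u \<ominus> adj A u = (2 * \<i>) \<odot> s"
  proof -
    have "\<ominus> ((- \<i>) \<odot> s) = \<i> \<odot> s" using sA by (simp flip: scalar_minus_one)
    then have "u \<ominus> adj A u = \<i> \<odot> s \<oplus> \<i> \<odot> s"
      using xA sA unfolding adu unfolding u_def by (simp add: minus_eq minus_add a_ac r_neg2)
    then show ?thesis using scalar_add_left[OF sA, of \<i> \<i>] by simp
  qed
  then have "2 * nrm A s \<le> 2"
    using nrm_diff[OF uA adj_closed[OF uA]] nrm_adj[OF uA] nu nrm_smult[OF sA, of "2 * \<i>"]
    by (simp add: norm_mult)
  then have "nrm A s \<le> 1" by simp
  then show ?thesis
    using nrm_square[OF s(1)] nrm_nonneg[OF sA] unfolding s(2) by (simp add: power_le_one)
qed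

theorem sum_of_squares:
  assumes x: "x \<in> self_adjoint A" and y: "y \<in> self_adjoint A"
  obtains z where "z \<in> self_adjoint A" "z \<otimes> z = x \<otimes> x \<oplus> y \<otimes> y"
proof -
  note xA = self_adjointD(1)[OF x] and yA = self_adjointD(1)[OF y]
  \<comment> \<open>Adding 1 keeps r positive even when both norms are 0, so division by r is
    safe.\<close>
  define r where "r = max (nrm A x) (nrm A y) + 1"
  have r: "r > 0" "nrm A x \<le> r" "nrm A y \<le> r" using nrm_nonneg[OF xA] by (auto simp: r_def)
  define p where "p = complex_of_real (1/r) \<odot> x"
  define q where "q = complex_of_real (1/r) \<odot> y"
  have p: "p \<in> self_adjoint A" "nrm A p \<le> 1" and q: "q \<in> self_adjoint A" "nrm A q \<le> 1"
    using r xA yA self_adjoint_real_scalar[OF x, of "1/r"] self_adjoint_real_scalar[OF y, of "1/r"]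
    unfolding p_def q_def by (simp_all add: nrm_smult norm_divide)
  note pA = self_adjointD(1)[OF p(1)] and qA = self_adjointD(1)[OF q(1)]
  \<comment> \<open>As the mean of 1 - p^2 and 1 - q^2, each of norm at most 1, t has norm at most
    1; and 1 - t is (p^2 + q^2)/2.\<close>
  define t where "t = (1/2) \<odot> ((\<one> \<ominus> p \<otimes> p) \<oplus> (\<one> \<ominus> q \<otimes> q))"
  have "complex_of_real (1/2) \<odot> ((\<one> \<ominus> p \<otimes> p) \<oplus> (\<one> \<ominus> q \<otimes> q)) \<in> self_adjoint A"
    by (intro self_adjoint_real_scalar self_adjoint_add self_adjoint_diff self_adjoint_one
        self_adjoint_square p q)
  then have t_sa: "t \<in> self_adjoint A" by (simp add: t_def)
  have "nrm A t \<le> 1"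
    using nrm_add[of "\<one> \<ominus> p \<otimes> p" "\<one> \<ominus> q \<otimes> q"] nrm_one_minus_square[OF p] nrm_one_minus_square[OF q]
      pA qA by (simp add: t_def nrm_smult norm_divide)
  then obtain s where s: "s \<in> self_adjoint A" "s \<otimes> s = \<one> \<ominus> t" using sqrt_one_minus t_sa by blast
  note sA = self_adjointD(1)[OF s(1)] and tA = self_adjointD(1)[OF t_sa]
  have "2 \<odot> t = (\<one> \<ominus> p \<otimes> p) \<oplus> (\<one> \<ominus> q \<otimes> q)" using pA qA by (simp add: t_def)
  moreover have "2 \<odot> (s \<otimes> s) = (\<one> \<oplus> \<one>) \<ominus> 2 \<odot> t"
    unfolding s(2) using tA scalar_add_left[of \<one> 1 1] 
    by (simp add: minus_eq scalar_add_right flip: scalar_minus_one)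
  moreover have "(\<one> \<oplus> \<one>) \<ominus> ((\<one> \<ominus> p \<otimes> p) \<oplus> (\<one> \<ominus> q \<otimes> q)) = p \<otimes> p \<oplus> q \<otimes> q"
    using pA qA by algebra
  ultimately have two: "2 \<odot> (s \<otimes> s) = p \<otimes> p \<oplus> q \<otimes> q" by simp
  have rr: "complex_of_real (r * r) \<odot> ((complex_of_real (1/r) \<odot> v) \<otimes> (complex_of_real (1/r) \<odot> v)) = v \<otimes> v"
    if "v \<in> carrier A" for v
  proof -
    have "complex_of_real (r * r) * (complex_of_real (1/r) * complex_of_real (1/r)) = 1"
      using r(1) by (simp del: of_real_mult of_real_divide flip: of_real_mult)
    then show ?thesis
      using that by (simp add: smult_mult_left smult_mult_right del: of_real_mult of_real_divide)
  qed
  \<comment> \<open>The root s satisfies 2 s^2 = p^2 + q^2 with p = x/r and q = y/r; the factor sqrt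
    2 * r removes both the 2 and the scaling.\<close>
  define z where "z = complex_of_real (sqrt 2 * r) \<odot> s"
  show thesis
  proof
    show "z \<in> self_adjoint A" unfolding z_def by (intro self_adjoint_real_scalar s)
    have "(sqrt 2 * r) * (sqrt 2 * r) = (sqrt 2 * sqrt 2) * (r * r)" by (simp only: mult_ac)
    then have "(sqrt 2 * r) * (sqrt 2 * r) = (r * r) * 2" by simp
    then have "complex_of_real (sqrt 2 * r) * complex_of_real (sqrt 2 * r) = complex_of_real (r * r) * 2"
      by (metis of_real_mult of_real_numeral)
    then have "z \<otimes> z = complex_of_real (r * r) \<odot> (2 \<odot> (s \<otimes> s))"
      using sA by (simp add: z_def smult_mult_left smult_mult_right del: of_real_mult)
    also have "\<dots> = complex_of_real (r * r) \<odot> (p \<otimes> p) \<oplus> complex_of_real (r * r) \<odot> (q \<otimes> q)"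
      unfolding two using pA qA by (simp add: scalar_add_right)
    also have "\<dots> = x \<otimes> x \<oplus> y \<otimes> y"
      unfolding p_def q_def by (simp only: rr xA yA)
    finally show "z \<otimes> z = x \<otimes> x \<oplus> y \<otimes> y" .
  qed
qed

end

section \<open>Internal C*-algebras\<close>

text \<open>If h computes the function pointwise, \<open>los\<close> puts \<open>e h\<close> into
  the extended graph, and functionality resolves the definite description in
  \<open>star_app\<close>. Functionality is phrased by \<open>butlast\<close> and
  \<open>last\<close> so that it is checked by simplification for graphs made of explicit
  lists.\<close>

lemma (in ultrapower) star_app_e:
  assumes "\<And>l l'. l \<in> G \<Longrightarrow> l' \<in> G \<Longrightarrow> butlast l = butlast l' \<Longrightarrow> last l = last l'"
    and "\<And>s. map (\<lambda>f. f s) fs @ [h s] \<in> G"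
  shows "star_app V G (map e fs) = e h"
proof -
  have fn: "p = q" if "map e fs @ [p] \<in> star_rel V G" "map e fs @ [q] \<in> star_rel V G" for p q
  proof (rule functional[OF _ that])
    fix xs y z assume "xs @ [y] \<in> G" "xs @ [z] \<in> G"
    from assms(1)[OF this] show "y = z" by simp
  qed
  have in_G: "map e fs @ [e h] \<in> star_rel V G"
    using los[of "fs @ [h]" G] assms(2) by simp
  show ?thesis
    unfolding star_app_def by (rule the_equality, rule in_G, rule fn[OF _ in_G])
qed

text \<open>Here \<open>i\<close> represents the code of the internal algebra, so \<open>M\<close>
  behaves as the ultraproduct of the algebras \<open>A (i s)\<close>. Only almost every factor is
  known to be a C*-algebra, so facts about the factors enter under
  \<open>eventually\<close>.\<close>

locale internal_ultrapower = ultrapower V U e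
  for V :: "('u, 'n) universe" and U :: "'u list filter" and e :: "('u list \<Rightarrow> 'u) \<Rightarrow> 'n" +
  fixes A :: "'u \<Rightarrow> (complex, real, 'u) star_algebra" and i :: "'u list \<Rightarrow> 'u"
  assumes inj_num: "inj (num V)"
    and cstar: "eventually (\<lambda>s. cstar_algebra (A (i s))) U"
begin

abbreviation "M \<equiv> internal_structure V A (e i)"

lemma carrier_e: "e f \<in> carrier M \<longleftrightarrow> eventually (\<lambda>s. f s \<in> carrier (A (i s))) U"
  using los[of "[i, f]" "{[i, x] | i x. x \<in> carrier (A i)}"] by (simp add: internal_structure_def)

lemma mult_e: "e f \<otimes>\<^bsub>M\<^esub> e g = e (\<lambda>s. f s \<otimes>\<^bsub>A (i s)\<^esub> g s)"
proof -
  have "star_app V {[i, x, y, x \<otimes>\<^bsub>A i\<^esub> y] | i x y. True} (map e [i, f, g])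
      = e (\<lambda>s. f s \<otimes>\<^bsub>A (i s)\<^esub> g s)"
    by (rule star_app_e) auto
  then show ?thesis by (simp add: internal_structure_def)
qed

lemma add_e: "e f \<oplus>\<^bsub>M\<^esub> e g = e (\<lambda>s. f s \<oplus>\<^bsub>A (i s)\<^esub> g s)"
proof -
  have "star_app V {[i, x, y, x \<oplus>\<^bsub>A i\<^esub> y] | i x y. True} (map e [i, f, g])
      = e (\<lambda>s. f s \<oplus>\<^bsub>A (i s)\<^esub> g s)"
    by (rule star_app_e) auto
  then show ?thesis by (simp add: internal_structure_def)
qed

lemma one_e: "\<one>\<^bsub>M\<^esub> = e (\<lambda>s. \<one>\<^bsub>A (i s)\<^esub>)"
proof -
  have "star_app V {[i, \<one>\<^bsub>A i\<^esub>] | i. True} (map e [i]) = e (\<lambda>s. \<one>\<^bsub>A (i s)\<^esub>)"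
    by (rule star_app_e) auto
  then show ?thesis by (simp add: internal_structure_def)
qed

lemma zero_e: "\<zero>\<^bsub>M\<^esub> = e (\<lambda>s. \<zero>\<^bsub>A (i s)\<^esub>)"
proof -
  have "star_app V {[i, \<zero>\<^bsub>A i\<^esub>] | i. True} (map e [i]) = e (\<lambda>s. \<zero>\<^bsub>A (i s)\<^esub>)"
    by (rule star_app_e) auto
  then show ?thesis by (simp add: internal_structure_def)
qed

lemma adj_e: "adj M (e f) = e (\<lambda>s. adj (A (i s)) (f s))"
proof -
  have "star_app V {[i, x, adj (A i) x] | i x. True} (map e [i, f])
      = e (\<lambda>s. adj (A (i s)) (f s))"
    by (rule star_app_e) auto
  then show ?thesis by (simp add: internal_structure_def)
qed

lemma nrm_e: "nrm M (e f) = e (\<lambda>s. rnum V (nrm (A (i s)) (f s)))"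
proof -
  have "star_app V {[i, x, rnum V (nrm (A i) x)] | i x. True} (map e [i, f])
      = e (\<lambda>s. rnum V (nrm (A (i s)) (f s)))"
    by (rule star_app_e) auto
  then show ?thesis by (simp add: internal_structure_def)
qed

lemma rnum_eq_iff [simp]: "rnum V x = rnum V y \<longleftrightarrow> x = y"
  using inj_num by (simp add: inj_eq)

lemma num_zero_eq_iff [simp]: "num V 0 = rnum V y \<longleftrightarrow> y = 0"
  using rnum_eq_iff[of 0 y] by auto

lemma finite_hyperreal_e:
  "finite_hyperreal V (e (\<lambda>s. rnum V (g s))) \<longleftrightarrow> (\<exists>n::nat. eventually (\<lambda>s. \<bar>g s\<bar> < real n) U)"
proof -
  have "[e (\<lambda>s. rnum V (g s))] \<in> star_rel V {[rnum V x] | x. \<bar>x\<bar> < real n}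
      \<longleftrightarrow> eventually (\<lambda>s. \<bar>g s\<bar> < real n) U" for n
    using los[of "[\<lambda>s. rnum V (g s)]" "{[rnum V x] | x. \<bar>x\<bar> < real n}"] by simp
  then show ?thesis unfolding finite_hyperreal_def by blast
qed

text \<open>For each standard n the condition is one standard relation, to which \<open>los\<close>
  applies, with the standard zero entering as a constant function. Every positive real exceeds some
  1/n, so all n together express convergence along \<open>U\<close>.\<close>

lemma approx_zero_e:
  "approx V (e (\<lambda>s. rnum V (g s))) (star_el V (rnum V 0)) \<longleftrightarrow> (g \<longlongrightarrow> 0) U"
proof -
  have "[e (\<lambda>s. rnum V (g s)), star_el V (rnum V 0)]
        \<in> star_rel V {[rnum V x, rnum V y] | x y. \<bar>x - y\<bar> < 1 / real n}
      \<longleftrightarrow> eventually (\<lambda>s. \<bar>g s\<bar> < 1 / real n) U" for n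
    using los[of "[\<lambda>s. rnum V (g s), \<lambda>s. rnum V 0]" "{[rnum V x, rnum V y] | x y. \<bar>x - y\<bar> < 1 / real n}"]
    unfolding e_const[symmetric] by simp
  then have "approx V (e (\<lambda>s. rnum V (g s))) (star_el V (rnum V 0))
      \<longleftrightarrow> (\<forall>n::nat. n \<ge> 1 \<longrightarrow> eventually (\<lambda>s. \<bar>g s\<bar> < 1 / real n) U)"
    unfolding approx_def by simp
  also have "\<dots> \<longleftrightarrow> (g \<longlongrightarrow> 0) U"
  proof
    assume *: "\<forall>n::nat. n \<ge> 1 \<longrightarrow> eventually (\<lambda>s. \<bar>g s\<bar> < 1 / real n) U"
    show "(g \<longlongrightarrow> 0) U"
    proof (rule tendstoI)
      fix \<epsilon> :: real assume "\<epsilon> > 0"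
      then obtain n where "1 / real (Suc n) < \<epsilon>"
        using nat_approx_posE by blast
      moreover have "eventually (\<lambda>s. \<bar>g s\<bar> < 1 / real (Suc n)) U" using *[rule_format, of "Suc n"] by simp
      ultimately show "eventually (\<lambda>s. dist (g s) 0 < \<epsilon>) U"
        by (auto elim!: eventually_mono)
    qed
  next
    assume "(g \<longlongrightarrow> 0) U"
    then show "\<forall>n::nat. n \<ge> 1 \<longrightarrow> eventually (\<lambda>s. \<bar>g s\<bar> < 1 / real n) U"
      by (auto dest!: tendstoD simp: dist_real_def)
  qed
  finally show ?thesis .
qed

end

section \<open>Factorwise representation and the ring structure of an internal C*-algebra\<close>

lemma cstar_algebra_imp_ring: "cstar_algebra B \<Longrightarrow> ring B"
  by (rule cstar_algebra.axioms(2))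

locale internal_cstar =
  fixes V :: "('u, 'n) universe" and A :: "'u \<Rightarrow> (complex, real, 'u) star_algebra" and \<nu> :: 'n
    and M :: "('n, 'n, 'n) star_algebra" (structure)
  assumes inj_num: "inj (num V)" and transfer: "transfer_principle V"
    and code: "[\<nu>] \<in> star_rel V {[i] | i. cstar_algebra (A i)}"
    and M_def: "M = internal_structure V A \<nu>"
begin

text \<open>The code and three elements share one tuple, hence one ultrafilter; three elements are
  what associativity and distributivity require. The ultrafilter varies from use to use, but
  conclusions about \<open>M\<close> do not mention it and can be combined.\<close>

lemma pointwise:
  obtains U e i f g h where "internal_ultrapower V U e A i" "M = internal_structure V A (e i)"
    "x = e f" "y = e g" "z = e h"
proof -
  obtain U e where ue: "ultrapower V U e"
    and nth: "\<And>k. k < length [\<nu>, x, y, z] \<Longrightarrow> [\<nu>, x, y, z] ! k = e (\<lambda>s. s ! k)"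
    using ultrapower_exists[OF transfer] by blast
  interpret ultrapower V U e by (rule ue)
  have v: "\<nu> = e (\<lambda>s. s ! 0)" using nth[of 0] by simp
  have "eventually (\<lambda>s. cstar_algebra (A (s ! 0))) U"
    using code los[of "[\<lambda>s. s ! 0]" "{[i] | i. cstar_algebra (A i)}"] by (simp add: v)
  then have "internal_ultrapower V U e A (\<lambda>s. s ! 0)"
    by unfold_locales (rule inj_num)
  then show thesis
    using that[of U e "\<lambda>s. s ! 0" "\<lambda>s. s ! 1" "\<lambda>s. s ! 2" "\<lambda>s. s ! 3"] nth[of 1] nth[of 2] nth[of 3]
    by (simp add: M_def v)
qed


abbreviation "bounded \<equiv> fin_part V M (carrier M)"

definition infinitesimal :: "'n set" where
  "infinitesimal = {x \<in> carrier M. approx V (nrm M x) (star_el V (rnum V 0))}"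

end

context internal_ultrapower
begin

lemma fin_e:
  "e f \<in> fin_part V M (carrier M) \<longleftrightarrow> e f \<in> carrier M \<and>
    (\<exists>n::nat. eventually (\<lambda>s. \<bar>nrm (A (i s)) (f s)\<bar> < real n) U)"
  by (simp add: fin_part_def nrm_e finite_hyperreal_e)

lemma infinitesimal_e:
  "approx V (nrm M (e f)) (star_el V (rnum V 0)) \<longleftrightarrow> ((\<lambda>s. nrm (A (i s)) (f s)) \<longlongrightarrow> 0) U"
  by (simp only: nrm_e approx_zero_e)

end

context internal_cstar
begin

lemma ring_M: "ring M"
proof (intro ringI abelian_groupI monoidI)
  fix x y z
  obtain U e i f g h where ue: "internal_ultrapower V U e A i" and M: "M = internal_structure V A (e i)"
    and xyz: "x = e f" "y = e g" "z = e h" by (rule pointwise)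
  interpret internal_ultrapower V U e A i by (rule ue)
  note ops = M xyz carrier_e mult_e add_e one_e zero_e e_eq
  {
    assume "x \<in> carrier M" "y \<in> carrier M"
    then show "x \<oplus> y \<in> carrier M" "x \<otimes> y \<in> carrier M" "x \<oplus> y = y \<oplus> x"
      using cstar unfolding ops
      by (eventually_elim, simp add: ring.ring_simprules cstar_algebra_imp_ring)+
  next
    show "\<zero> \<in> carrier M" "\<one> \<in> carrier M"
      using cstar unfolding ops
      by (eventually_elim, simp add: ring.ring_simprules cstar_algebra_imp_ring)+
  next
    assume "x \<in> carrier M"
    then show "\<zero> \<oplus> x = x" "\<one> \<otimes> x = x" "x \<otimes> \<one> = x"
      using cstar unfolding ops
      by (eventually_elim, simp add: ring.ring_simprules cstar_algebra_imp_ring ring.is_monoid monoid.r_one)+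
    show "\<exists>w\<in>carrier M. w \<oplus> x = \<zero>"
    proof
      show "e (\<lambda>s. \<ominus>\<^bsub>A (i s)\<^esub> f s) \<in> carrier M" "e (\<lambda>s. \<ominus>\<^bsub>A (i s)\<^esub> f s) \<oplus> x = \<zero>"
        using cstar \<open>x \<in> carrier M\<close> unfolding ops
        by (eventually_elim, simp add: ring.ring_simprules cstar_algebra_imp_ring)+
    qed
  next
    assume "x \<in> carrier M" "y \<in> carrier M" "z \<in> carrier M"
    then show "(x \<oplus> y) \<oplus> z = x \<oplus> (y \<oplus> z)" "(x \<otimes> y) \<otimes> z = x \<otimes> (y \<otimes> z)"
      "(x \<oplus> y) \<otimes> z = x \<otimes> z \<oplus> y \<otimes> z" "z \<otimes> (x \<oplus> y) = z \<otimes> x \<oplus> z \<otimes> y"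
      using cstar unfolding ops
      by (eventually_elim, simp add: ring.ring_simprules cstar_algebra_imp_ring)+
  }
qed


sublocale MR: ring M by (rule ring_M)

text \<open>Subtraction is not a field of the record but is derived from the additive inverse, so
  \<open>star_app\<close> does not compute it. Cancellation in the ring \<open>M\<close> identifies
  it with the factorwise difference, whence the membership premises.\<close>

lemma minus_e:
  assumes "internal_ultrapower V U e A i" and M: "M = internal_structure V A (e i)"
    and "e f \<in> carrier M" "e g \<in> carrier M"
  shows "e f \<ominus> e g = e (\<lambda>s. f s \<ominus>\<^bsub>A (i s)\<^esub> g s)"
proof -
  interpret internal_ultrapower V U e A i by fact
  note ops = M carrier_e mult_e add_e zero_e e_eq
  have "e (\<lambda>s. f s \<ominus>\<^bsub>A (i s)\<^esub> g s) \<in> carrier M"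
    and "e f = e (\<lambda>s. f s \<ominus>\<^bsub>A (i s)\<^esub> g s) \<oplus> e g"
    using cstar assms(3,4) unfolding ops
    by (eventually_elim, simp add: ring.ring_simprules cstar_algebra_imp_ring)+
  with assms(4) show ?thesis by (simp add: MR.minus_eq MR.a_assoc MR.r_neg)
qed

lemma adj_closed: "x \<in> carrier M \<Longrightarrow> adj M x \<in> carrier M"
proof -
  assume x: "x \<in> carrier M"
  obtain U e i f where ue: "internal_ultrapower V U e A i" and M: "M = internal_structure V A (e i)"
    and "x = e f" by (rule pointwise[where ?x = x])
  interpret internal_ultrapower V U e A i by (rule ue)
  show ?thesis
    using cstar x unfolding M \<open>x = e f\<close> adj_e carrier_e
    by eventually_elim (simp add: cstar_algebra.adj_closed)
qed

lemma adj_diff: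
  assumes "x \<in> carrier M" "y \<in> carrier M"
  shows "adj M x \<ominus> adj M y = adj M (x \<ominus> y)"
proof -
  obtain U e i f g where ue: "internal_ultrapower V U e A i" and M: "M = internal_structure V A (e i)"
    and xy: "x = e f" "y = e g" by (rule pointwise[where ?x = x and ?y = y])
  interpret internal_ultrapower V U e A i by (rule ue)
  have m: "e f \<ominus> e g = e (\<lambda>s. f s \<ominus>\<^bsub>A (i s)\<^esub> g s)"
    by (rule minus_e[OF ue M]) (simp_all only: xy[symmetric] assms)
  have a: "adj M x = e (\<lambda>s. adj (A (i s)) (f s))" "adj M y = e (\<lambda>s. adj (A (i s)) (g s))"
    by (simp_all add: M xy adj_e)
  have "adj M x \<ominus> adj M y = e (\<lambda>s. adj (A (i s)) (f s) \<ominus>\<^bsub>A (i s)\<^esub> adj (A (i s)) (g s))"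
    unfolding a by (rule minus_e[OF ue M]) (simp_all only: a[symmetric] adj_closed assms)
  also have "\<dots> = adj M (x \<ominus> y)"
    using cstar assms unfolding xy m unfolding M adj_e e_eq carrier_e
    by eventually_elim (simp add: cstar_algebra.adj_diff)
  finally show ?thesis .
qed

end

section \<open>Bounded elements and the ideal of infinitesimals\<close>

context internal_ultrapower
begin

lemma bounded_e:
  "e f \<in> fin_part V M (carrier M) \<longleftrightarrow>
    eventually (\<lambda>s. f s \<in> carrier (A (i s))) U \<and> (\<exists>n::nat. eventually (\<lambda>s. nrm (A (i s)) (f s) < real n) U)"
proof (cases "eventually (\<lambda>s. f s \<in> carrier (A (i s))) U")
  case True
  then have "eventually (\<lambda>s. \<bar>nrm (A (i s)) (f s)\<bar> = nrm (A (i s)) (f s)) U"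
    using cstar by eventually_elim (simp add: cstar_algebra.nrm_nonneg)
  then have "eventually (\<lambda>s. \<bar>nrm (A (i s)) (f s)\<bar> < r) U \<longleftrightarrow> eventually (\<lambda>s. nrm (A (i s)) (f s) < r) U" for r
    by (rule eventually_subst[OF eventually_mono]) simp
  then show ?thesis by (simp add: fin_e carrier_e)
qed (simp add: fin_e carrier_e)

lemma tendsto_zero_if_le:
  assumes "(h \<longlongrightarrow> (0::real)) U" "eventually (\<lambda>s. 0 \<le> k s \<and> k s \<le> h s) U"
  shows "(k \<longlongrightarrow> 0) U"
  by (rule tendsto_sandwich[OF _ _ tendsto_const assms(1)]) (use assms(2) in \<open>auto elim: eventually_mono\<close>)

end

context internal_cstar
begin

lemma infinitesimal_iff_e:
  assumes "internal_ultrapower V U e A i" and M: "M = internal_structure V A (e i)"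
  shows "e f \<in> infinitesimal \<longleftrightarrow>
    eventually (\<lambda>s. f s \<in> carrier (A (i s))) U \<and> ((\<lambda>s. nrm (A (i s)) (f s)) \<longlongrightarrow> 0) U"
proof -
  interpret internal_ultrapower V U e A i by fact
  show ?thesis unfolding infinitesimal_def unfolding M using infinitesimal_e[of f] by (simp add: carrier_e)
qed

lemma
  assumes "x \<in> infinitesimal" "y \<in> infinitesimal"
  shows infinitesimal_add: "x \<oplus> y \<in> infinitesimal"
    and infinitesimal_diff: "x \<ominus> y \<in> infinitesimal"
proof -
  obtain U e i f g where ue: "internal_ultrapower V U e A i" and M: "M = internal_structure V A (e i)"
    and xy: "x = e f" "y = e g" by (rule pointwise[where ?x = x and ?y = y])
  interpret internal_ultrapower V U e A i by (rule ue)
  note inf = infinitesimal_iff_e[OF ue M]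
  have f: "eventually (\<lambda>s. f s \<in> carrier (A (i s))) U" "((\<lambda>s. nrm (A (i s)) (f s)) \<longlongrightarrow> 0) U"
    and g: "eventually (\<lambda>s. g s \<in> carrier (A (i s))) U" "((\<lambda>s. nrm (A (i s)) (g s)) \<longlongrightarrow> 0) U"
    using assms unfolding xy inf by auto
  have add: "x \<oplus> y = e (\<lambda>s. f s \<oplus>\<^bsub>A (i s)\<^esub> g s)"
    by (simp add: M xy add_e)
  have diff: "x \<ominus> y = e (\<lambda>s. f s \<ominus>\<^bsub>A (i s)\<^esub> g s)"
    unfolding xy by (rule minus_e[OF ue M]) (use f g in \<open>simp_all add: M carrier_e\<close>)
  have sum: "((\<lambda>s. nrm (A (i s)) (f s) + nrm (A (i s)) (g s)) \<longlongrightarrow> 0) U"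
    using tendsto_add[OF f(2) g(2)] by simp
  show "x \<oplus> y \<in> infinitesimal"
    unfolding add inf
  proof
    show "eventually (\<lambda>s. f s \<oplus>\<^bsub>A (i s)\<^esub> g s \<in> carrier (A (i s))) U"
      using cstar f(1) g(1) by eventually_elim (simp add: ring.ring_simprules cstar_algebra_imp_ring)
    show "((\<lambda>s. nrm (A (i s)) (f s \<oplus>\<^bsub>A (i s)\<^esub> g s)) \<longlongrightarrow> 0) U"
      by (rule tendsto_zero_if_le[OF sum])
        (use cstar f(1) g(1) in \<open>eventually_elim, simp add: ring.ring_simprules
          cstar_algebra_imp_ring cstar_algebra.nrm_add cstar_algebra.nrm_nonneg\<close>)
  qed
  show "x \<ominus> y \<in> infinitesimal"
    unfolding diff inf
  proof
    show "eventually (\<lambda>s. f s \<ominus>\<^bsub>A (i s)\<^esub> g s \<in> carrier (A (i s))) U"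
      using cstar f(1) g(1) by eventually_elim (simp add: ring.ring_simprules cstar_algebra_imp_ring)
    show "((\<lambda>s. nrm (A (i s)) (f s \<ominus>\<^bsub>A (i s)\<^esub> g s)) \<longlongrightarrow> 0) U"
      by (rule tendsto_zero_if_le[OF sum])
        (use cstar f(1) g(1) in \<open>eventually_elim, simp add: ring.ring_simprules(4)
          cstar_algebra_imp_ring cstar_algebra.nrm_diff cstar_algebra.nrm_nonneg\<close>)
  qed
qed

lemma
  assumes "x \<in> infinitesimal"
  shows infinitesimal_adj: "adj M x \<in> infinitesimal"
    and infinitesimal_bounded: "x \<in> bounded"
proof -
  obtain U e i f where ue: "internal_ultrapower V U e A i" and M: "M = internal_structure V A (e i)"
    and x: "x = e f" by (rule pointwise[where ?x = x])
  interpret internal_ultrapower V U e A i by (rule ue)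
  note inf = infinitesimal_iff_e[OF ue M]
  have f: "eventually (\<lambda>s. f s \<in> carrier (A (i s))) U" "((\<lambda>s. nrm (A (i s)) (f s)) \<longlongrightarrow> 0) U"
    using assms unfolding x inf by auto
  have adj: "adj M x = e (\<lambda>s. adj (A (i s)) (f s))"
    by (simp add: M x adj_e)
  show "adj M x \<in> infinitesimal"
    unfolding adj inf
  proof
    show "eventually (\<lambda>s. adj (A (i s)) (f s) \<in> carrier (A (i s))) U"
      using cstar f(1) by eventually_elim (simp add: cstar_algebra.adj_closed)
    show "((\<lambda>s. nrm (A (i s)) (adj (A (i s)) (f s))) \<longlongrightarrow> 0) U"
      by (rule tendsto_zero_if_le[OF f(2)])
        (use cstar f(1) in \<open>eventually_elim, simp add: cstar_algebra.nrm_adj cstar_algebra.nrm_nonneg\<close>)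
  qed
  have "eventually (\<lambda>s. nrm (A (i s)) (f s) < 1) U"
    using order_tendstoD(2)[OF f(2), of 1] by simp
  then show "x \<in> bounded"
    using f(1) unfolding x unfolding M bounded_e by (metis of_nat_1)
qed

text \<open>If norm (f s) is below n for almost all s, then n * norm (g s) dominates both products
  and tends to 0. So the infinitesimals are a two-sided ideal among the bounded elements, which
  makes multiplication on the hull well defined.\<close>

lemma
  assumes "x \<in> bounded" "y \<in> infinitesimal"
  shows mult_infinitesimal: "x \<otimes> y \<in> infinitesimal"
    and infinitesimal_mult: "y \<otimes> x \<in> infinitesimal"
proof -
  obtain U e i f g where ue: "internal_ultrapower V U e A i" and M: "M = internal_structure V A (e i)"
    and xy: "x = e f" "y = e g" by (rule pointwise[where ?x = x and ?y = y])
  interpret internal_ultrapower V U e A i by (rule ue)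
  note inf = infinitesimal_iff_e[OF ue M]
  obtain n :: nat where f: "eventually (\<lambda>s. f s \<in> carrier (A (i s))) U" "eventually (\<lambda>s. nrm (A (i s)) (f s) < n) U"
    using assms(1) unfolding xy unfolding M bounded_e by blast
  have g: "eventually (\<lambda>s. g s \<in> carrier (A (i s))) U" "((\<lambda>s. nrm (A (i s)) (g s)) \<longlongrightarrow> 0) U"
    using assms(2) unfolding xy inf by auto
  have m: "x \<otimes> y = e (\<lambda>s. f s \<otimes>\<^bsub>A (i s)\<^esub> g s)" "y \<otimes> x = e (\<lambda>s. g s \<otimes>\<^bsub>A (i s)\<^esub> f s)"
    by (simp_all add: M xy mult_e)
  have lim: "((\<lambda>s. real n * nrm (A (i s)) (g s)) \<longlongrightarrow> 0) U"
    using tendsto_mult_left[OF g(2), of "real n"] by simp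
  have le: "nrm B (a \<otimes>\<^bsub>B\<^esub> b) \<le> real n * nrm B b" "nrm B (b \<otimes>\<^bsub>B\<^esub> a) \<le> real n * nrm B b"
    if "cstar_algebra B" "a \<in> carrier B" "b \<in> carrier B" "nrm B a < n" for B and a b :: 'u
  proof -
    have "nrm B a * nrm B b \<le> real n * nrm B b"
      using that by (intro mult_right_mono) (auto simp: cstar_algebra.nrm_nonneg)
    then show "nrm B (a \<otimes>\<^bsub>B\<^esub> b) \<le> real n * nrm B b" "nrm B (b \<otimes>\<^bsub>B\<^esub> a) \<le> real n * nrm B b"
      using cstar_algebra.nrm_mult[OF that(1-3)] cstar_algebra.nrm_mult[OF that(1,3,2)]
      by (simp_all add: mult.commute)
  qed
  show "x \<otimes> y \<in> infinitesimal"
    unfolding m inf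
  proof
    show "eventually (\<lambda>s. f s \<otimes>\<^bsub>A (i s)\<^esub> g s \<in> carrier (A (i s))) U"
      using cstar f(1) g(1) by eventually_elim (simp add: ring.ring_simprules cstar_algebra_imp_ring)
    show "((\<lambda>s. nrm (A (i s)) (f s \<otimes>\<^bsub>A (i s)\<^esub> g s)) \<longlongrightarrow> 0) U"
      by (rule tendsto_zero_if_le[OF lim])
        (use cstar f g(1) in \<open>eventually_elim, simp add: ring.ring_simprules(5) le
          cstar_algebra_imp_ring cstar_algebra.nrm_nonneg\<close>)
  qed
  show "y \<otimes> x \<in> infinitesimal"
    unfolding m inf
  proof
    show "eventually (\<lambda>s. g s \<otimes>\<^bsub>A (i s)\<^esub> f s \<in> carrier (A (i s))) U"
      using cstar f(1) g(1) by eventually_elim (simp add: ring.ring_simprules cstar_algebra_imp_ring)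
    show "((\<lambda>s. nrm (A (i s)) (g s \<otimes>\<^bsub>A (i s)\<^esub> f s)) \<longlongrightarrow> 0) U"
      by (rule tendsto_zero_if_le[OF lim])
        (use cstar f g(1) in \<open>eventually_elim, simp add: ring.ring_simprules(5) le
          cstar_algebra_imp_ring cstar_algebra.nrm_nonneg\<close>)
  qed
qed

lemma
  assumes "x \<in> bounded" "y \<in> bounded"
  shows bounded_add: "x \<oplus> y \<in> bounded"
    and bounded_diff: "x \<ominus> y \<in> bounded"
    and bounded_mult: "x \<otimes> y \<in> bounded"
proof -
  obtain U e i f g where ue: "internal_ultrapower V U e A i" and M: "M = internal_structure V A (e i)"
    and xy: "x = e f" "y = e g" by (rule pointwise[where ?x = x and ?y = y])
  interpret internal_ultrapower V U e A i by (rule ue)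
  obtain n :: nat where f: "eventually (\<lambda>s. f s \<in> carrier (A (i s))) U" "eventually (\<lambda>s. nrm (A (i s)) (f s) < n) U"
    using assms(1) unfolding xy unfolding M bounded_e by blast
  obtain m :: nat where g: "eventually (\<lambda>s. g s \<in> carrier (A (i s))) U" "eventually (\<lambda>s. nrm (A (i s)) (g s) < m) U"
    using assms(2) unfolding xy unfolding M bounded_e by blast
  have ops: "x \<oplus> y = e (\<lambda>s. f s \<oplus>\<^bsub>A (i s)\<^esub> g s)" "x \<otimes> y = e (\<lambda>s. f s \<otimes>\<^bsub>A (i s)\<^esub> g s)"
    by (simp_all add: M xy add_e mult_e)
  have diff: "x \<ominus> y = e (\<lambda>s. f s \<ominus>\<^bsub>A (i s)\<^esub> g s)"
    unfolding xy by (rule minus_e[OF ue M]) (use f g in \<open>simp_all add: M carrier_e\<close>)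
  \<comment> \<open>Sum, difference and product are handled alike: \<open>F\<close> is an operation
    available in every C*-algebra, and a norm estimate in a single ordinary algebra
    suffices.\<close>
  have boundedI: "e (\<lambda>s. F (A (i s)) (f s) (g s)) \<in> bounded"
    if "\<And>B a b. \<lbrakk>cstar_algebra B; a \<in> carrier B; b \<in> carrier B; nrm B a < real n; nrm B b < real m\<rbrakk>
      \<Longrightarrow> F B a b \<in> carrier B \<and> nrm B (F B a b) < real k"
    for F :: "(complex, real, 'u) star_algebra \<Rightarrow> 'u \<Rightarrow> 'u \<Rightarrow> 'u" and k :: nat
  proof -
    have "eventually (\<lambda>s. F (A (i s)) (f s) (g s) \<in> carrier (A (i s)) \<and>
        nrm (A (i s)) (F (A (i s)) (f s) (g s)) < real k) U"
      using cstar f g by eventually_elim (simp add: that)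
    then show ?thesis unfolding M bounded_e eventually_conj_iff by blast
  qed
  show "x \<oplus> y \<in> bounded"
    unfolding ops
  proof (rule boundedI[of _ "n + m"], intro conjI)
    fix B and a b :: 'u
    assume "cstar_algebra B" and *: "a \<in> carrier B" "b \<in> carrier B" "nrm B a < real n" "nrm B b < real m"
    then interpret cstar_algebra B by blast
    show "a \<oplus>\<^bsub>B\<^esub> b \<in> carrier B" "nrm B (a \<oplus>\<^bsub>B\<^esub> b) < real (n + m)"
      using * nrm_add[of a b] by auto
  qed
  show "x \<ominus> y \<in> bounded"
    unfolding diff
  proof (rule boundedI[of _ "n + m"], intro conjI)
    fix B and a b :: 'u
    assume "cstar_algebra B" and *: "a \<in> carrier B" "b \<in> carrier B" "nrm B a < real n" "nrm B b < real m"
    then interpret cstar_algebra B by blast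
    show "a \<ominus>\<^bsub>B\<^esub> b \<in> carrier B" "nrm B (a \<ominus>\<^bsub>B\<^esub> b) < real (n + m)"
      using * nrm_diff[of a b] by auto
  qed
  show "x \<otimes> y \<in> bounded"
    unfolding ops
  proof (rule boundedI[of _ "n * m"], intro conjI)
    fix B and a b :: 'u
    assume "cstar_algebra B" and *: "a \<in> carrier B" "b \<in> carrier B" "nrm B a < real n" "nrm B b < real m"
    then interpret cstar_algebra B by blast
    show "a \<otimes>\<^bsub>B\<^esub> b \<in> carrier B" using * by simp
    have "nrm B a * nrm B b < real n * real m"
      using * nrm_nonneg[of a] nrm_nonneg[of b] by (intro mult_strict_mono') auto
    then show "nrm B (a \<otimes>\<^bsub>B\<^esub> b) < real (n * m)"
      using * nrm_mult[of a b] by simp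
  qed
qed

text \<open>By the C*-identity (norm d)^2 = norm (d^2) < n \<le> (n + 1)^2. It ensures that a finite
  positive element is the square of a finite self-adjoint one.\<close>

lemma self_adjoint_bounded_if_square_bounded:
  assumes d: "d \<in> self_adjoint M" and "d \<otimes> d \<in> bounded"
  shows "d \<in> bounded"
proof -
  obtain U e i f where ue: "internal_ultrapower V U e A i" and M: "M = internal_structure V A (e i)"
    and x: "d = e f" by (rule pointwise[where ?x = d])
  interpret internal_ultrapower V U e A i by (rule ue)
  have f: "eventually (\<lambda>s. f s \<in> carrier (A (i s))) U" "eventually (\<lambda>s. adj (A (i s)) (f s) = f s) U"
    using d unfolding x M by (auto simp: self_adjoint_def carrier_e adj_e e_eq)
  obtain n :: nat where n: "eventually (\<lambda>s. nrm (A (i s)) (f s \<otimes>\<^bsub>A (i s)\<^esub> f s) < n) U"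
    using assms(2) unfolding x unfolding M mult_e bounded_e by blast
  have "eventually (\<lambda>s. nrm (A (i s)) (f s) < real (Suc n)) U"
    using cstar f n
  proof eventually_elim
    case (elim s)
    interpret cstar_algebra "A (i s)" by (rule elim)
    have "(nrm (A (i s)) (f s))\<^sup>2 < real n"
      using elim cstar_identity[of "f s"] by simp
    also have "real n \<le> (real (Suc n))\<^sup>2" by (simp add: power2_eq_square algebra_simps)
    finally show ?case by (rule power2_less_imp_less) simp
  qed
  then show ?thesis using f(1) unfolding x unfolding M bounded_e by blast
qed

lemma near_self_adjoint:
  assumes "x \<in> carrier M" "adj M x \<ominus> x \<in> infinitesimal"
  obtains d where "d \<in> self_adjoint M" "d \<ominus> x \<in> infinitesimal"
proof -
  obtain U e i f where ue: "internal_ultrapower V U e A i" and M: "M = internal_structure V A (e i)"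
    and x: "x = e f" by (rule pointwise[where ?x = x])
  interpret internal_ultrapower V U e A i by (rule ue)
  note inf = infinitesimal_iff_e[OF ue M]
  have f: "eventually (\<lambda>s. f s \<in> carrier (A (i s))) U"
    using assms(1) by (simp add: M x carrier_e)
  have adj: "adj M x = e (\<lambda>s. adj (A (i s)) (f s))" by (simp add: M x adj_e)
  have "adj M x \<ominus> x = e (\<lambda>s. adj (A (i s)) (f s) \<ominus>\<^bsub>A (i s)\<^esub> f s)"
    using minus_e[OF ue M, of "\<lambda>s. adj (A (i s)) (f s)" f] adj_closed[OF assms(1)] assms(1)
    by (simp only: adj[symmetric] x[symmetric])
  then have lim: "((\<lambda>s. nrm (A (i s)) (adj (A (i s)) (f s) \<ominus>\<^bsub>A (i s)\<^esub> f s)) \<longlongrightarrow> 0) U"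
    using assms(2) inf by simp
  \<comment> \<open>The mean is formed in each factor with the ordinary scalar 1/2. Its difference
    from f is half of adj f - f, so the norm of that difference inherits the limit 0.\<close>
  define h where "h s = (1/2) \<odot>\<^bsub>A (i s)\<^esub> (adj (A (i s)) (f s) \<oplus>\<^bsub>A (i s)\<^esub> f s)" for s
  have h: "eventually (\<lambda>s. h s \<in> carrier (A (i s)) \<and> adj (A (i s)) (h s) = h s \<and>
      nrm (A (i s)) (h s \<ominus>\<^bsub>A (i s)\<^esub> f s) \<le> nrm (A (i s)) (adj (A (i s)) (f s) \<ominus>\<^bsub>A (i s)\<^esub> f s)) U"
    using cstar f
  proof eventually_elim
    case (elim s)
    let ?B = "A (i s)"
    interpret cstar_algebra ?B by (rule elim)
    note fs = elim(2) adj_closed[OF elim(2)]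
    have h: "h s \<in> carrier ?B" using fs by (simp add: h_def)
    moreover have "adj ?B (h s) = h s"
      using fs by (simp add: h_def adj_smult adj_add adj_adj a_comm)
    moreover have "h s \<ominus>\<^bsub>?B\<^esub> f s = (1/2) \<odot>\<^bsub>?B\<^esub> (adj ?B (f s) \<ominus>\<^bsub>?B\<^esub> f s)"
    proof -
      have "(1/2) \<odot>\<^bsub>?B\<^esub> f s \<oplus>\<^bsub>?B\<^esub> (1/2) \<odot>\<^bsub>?B\<^esub> f s = f s"
        using scalar_add_left[OF elim(2), of "1/2" "1/2"] fs by simp
      moreover have "(u \<oplus>\<^bsub>?B\<^esub> v) \<ominus>\<^bsub>?B\<^esub> (v \<oplus>\<^bsub>?B\<^esub> v) = u \<ominus>\<^bsub>?B\<^esub> v"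
        if "u \<in> carrier ?B" "v \<in> carrier ?B" for u v using that by algebra
      ultimately show ?thesis
        using fs by (metis h_def scalar_add_right scalar_closed scalar_diff_right)
    qed
    then have "nrm ?B (h s \<ominus>\<^bsub>?B\<^esub> f s) \<le> nrm ?B (adj ?B (f s) \<ominus>\<^bsub>?B\<^esub> f s)"
      using fs nrm_nonneg[of "adj ?B (f s) \<ominus>\<^bsub>?B\<^esub> f s"] by (simp add: nrm_smult norm_divide)
    ultimately show ?case by blast
  qed
  have hM: "e h \<in> carrier M" using h by (auto simp: M carrier_e elim: eventually_mono)
  have "e h \<in> self_adjoint M"
    using h hM by (auto simp: self_adjoint_def M adj_e e_eq elim: eventually_mono)
  moreover have "e h \<ominus> x = e (\<lambda>s. h s \<ominus>\<^bsub>A (i s)\<^esub> f s)"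
    unfolding x by (rule minus_e[OF ue M]) (simp_all only: x[symmetric] hM assms(1))
  moreover have "e (\<lambda>s. h s \<ominus>\<^bsub>A (i s)\<^esub> f s) \<in> infinitesimal"
    unfolding inf
  proof
    show "eventually (\<lambda>s. h s \<ominus>\<^bsub>A (i s)\<^esub> f s \<in> carrier (A (i s))) U"
      using cstar f h by eventually_elim (simp add: ring.ring_simprules(4) cstar_algebra_imp_ring)
    show "((\<lambda>s. nrm (A (i s)) (h s \<ominus>\<^bsub>A (i s)\<^esub> f s)) \<longlongrightarrow> 0) U"
      by (rule tendsto_zero_if_le[OF lim])
        (use cstar f h in \<open>eventually_elim, simp add: ring.ring_simprules(4) cstar_algebra_imp_ring
          cstar_algebra.nrm_nonneg\<close>)
  qed
  ultimately show thesis using that by simp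
qed

lemma internal_sum_of_squares:
  assumes "x \<in> self_adjoint M" "y \<in> self_adjoint M"
  shows "x \<otimes> x \<oplus> y \<otimes> y \<in> positive M"
proof -
  obtain U e i f g where ue: "internal_ultrapower V U e A i" and M: "M = internal_structure V A (e i)"
    and xy: "x = e f" "y = e g" by (rule pointwise[where ?x = x and ?y = y])
  interpret internal_ultrapower V U e A i by (rule ue)
  have sa: "e h \<in> self_adjoint M \<longleftrightarrow> eventually (\<lambda>s. h s \<in> self_adjoint (A (i s))) U" for h
    by (simp add: self_adjoint_def M carrier_e adj_e e_eq eventually_conj_iff)
  have "eventually (\<lambda>s. \<exists>z. z \<in> self_adjoint (A (i s)) \<and>
      z \<otimes>\<^bsub>A (i s)\<^esub> z = f s \<otimes>\<^bsub>A (i s)\<^esub> f s \<oplus>\<^bsub>A (i s)\<^esub> g s \<otimes>\<^bsub>A (i s)\<^esub> g s) U"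
    using cstar assms[unfolded xy sa] by eventually_elim (metis cstar_algebra.sum_of_squares)
  \<comment> \<open>Existence in almost every factor becomes one function by choosing a root for
    each index; \<open>e h\<close> is then the internal root.\<close>
  then obtain h where h: "eventually (\<lambda>s. h s \<in> self_adjoint (A (i s)) \<and>
      h s \<otimes>\<^bsub>A (i s)\<^esub> h s = f s \<otimes>\<^bsub>A (i s)\<^esub> f s \<oplus>\<^bsub>A (i s)\<^esub> g s \<otimes>\<^bsub>A (i s)\<^esub> g s) U"
    unfolding eventually_ex by blast
  then have "e h \<in> self_adjoint M" "e h \<otimes> e h = x \<otimes> x \<oplus> y \<otimes> y"
    unfolding sa unfolding M xy mult_e add_e e_eq by (simp_all add: eventually_conj_iff)
  then show ?thesis unfolding positive_def by force
qed


section \<open>The nonstandard hull\<close>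

lemma mem_hat_iff: "a \<in> carrier M \<Longrightarrow> x \<in> hat V M a \<longleftrightarrow> x \<in> carrier M \<and> x \<ominus> a \<in> infinitesimal"
  by (auto simp: hat_def infinitesimal_def)

lemma bounded_carrier: "x \<in> bounded \<Longrightarrow> x \<in> carrier M"
  by (simp add: fin_part_def)

lemma infinitesimal_trans:
  assumes "x \<in> carrier M" "y \<in> carrier M" "z \<in> carrier M" "x \<ominus> y \<in> infinitesimal" "y \<ominus> z \<in> infinitesimal"
  shows "x \<ominus> z \<in> infinitesimal"
proof -
  have "x \<ominus> z = (x \<ominus> y) \<oplus> (y \<ominus> z)" using assms(1-3) by algebra
  then show ?thesis using infinitesimal_add assms(4,5) by simp
qed

lemma infinitesimal_zero: "\<zero> \<in> infinitesimal"
proof -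
  obtain U e i where ue: "internal_ultrapower V U e A i" and M: "M = internal_structure V A (e i)"
    by (rule pointwise)
  interpret internal_ultrapower V U e A i by (rule ue)
  have zero: "\<zero> = e (\<lambda>s. \<zero>\<^bsub>A (i s)\<^esub>)" by (simp add: M zero_e)
  have "eventually (\<lambda>s. nrm (A (i s)) \<zero>\<^bsub>A (i s)\<^esub> = 0) U"
    using cstar by eventually_elim (rule cstar_algebra.nrm_zero)
  then have "((\<lambda>s. nrm (A (i s)) \<zero>\<^bsub>A (i s)\<^esub>) \<longlongrightarrow> 0) U" by (rule tendsto_eventually)
  moreover have "eventually (\<lambda>s. \<zero>\<^bsub>A (i s)\<^esub> \<in> carrier (A (i s))) U"
    using cstar by eventually_elim (simp add: ring.ring_simprules cstar_algebra_imp_ring)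
  ultimately show ?thesis unfolding zero infinitesimal_iff_e[OF ue M] by simp
qed

lemma infinitesimal_sym:
  assumes "x \<in> carrier M" "y \<in> carrier M" "x \<ominus> y \<in> infinitesimal"
  shows "y \<ominus> x \<in> infinitesimal"
proof -
  have "y \<ominus> x = \<zero> \<ominus> (x \<ominus> y)" using assms(1,2) by algebra
  then show ?thesis using infinitesimal_diff[OF infinitesimal_zero assms(3)] by simp
qed

lemma mem_hat_self: "a \<in> carrier M \<Longrightarrow> a \<in> hat V M a"
  using infinitesimal_zero by (simp add: mem_hat_iff MR.minus_eq MR.r_neg)

lemma hat_eq_iff:
  assumes "a \<in> carrier M" "b \<in> carrier M"
  shows "hat V M a = hat V M b \<longleftrightarrow> a \<ominus> b \<in> infinitesimal"
proof
  assume "hat V M a = hat V M b"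
  then show "a \<ominus> b \<in> infinitesimal" using mem_hat_self[of a] mem_hat_iff[of b a] assms by simp
next
  assume ab: "a \<ominus> b \<in> infinitesimal"
  note ba = infinitesimal_sym[OF assms ab]
  show "hat V M a = hat V M b"
    using infinitesimal_trans[OF _ assms _ ab] infinitesimal_trans[OF _ assms(2,1) _ ba] assms
    by (auto simp: mem_hat_iff)
qed

lemma bounded_if_near:
  assumes "x \<in> carrier M" "a \<in> bounded" "x \<ominus> a \<in> infinitesimal"
  shows "x \<in> bounded"
proof -
  have "x = (x \<ominus> a) \<oplus> a" using assms(1) bounded_carrier[OF assms(2)] by algebra
  then show ?thesis using bounded_add[OF infinitesimal_bounded[OF assms(3)] assms(2)] by simp
qed

text \<open>The hull operations act on an arbitrarily chosen \<open>rep\<close>. These two facts are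
  all that is used about the choice.\<close>

lemma rep_hat:
  assumes "a \<in> bounded"
  shows "rep (hat V M a) \<in> bounded" "rep (hat V M a) \<ominus> a \<in> infinitesimal"
proof -
  have a: "a \<in> carrier M" using assms by (rule bounded_carrier)
  have "rep (hat V M a) \<in> hat V M a"
    unfolding rep_def by (rule someI) (rule mem_hat_self[OF a])
  then have *: "rep (hat V M a) \<in> carrier M" "rep (hat V M a) \<ominus> a \<in> infinitesimal"
    using a by (auto simp: mem_hat_iff)
  show "rep (hat V M a) \<ominus> a \<in> infinitesimal" by (rule *(2))
  show "rep (hat V M a) \<in> bounded" by (rule bounded_if_near[OF *(1) assms *(2)])
qed

lemma hull_mult:
  assumes "a \<in> bounded" "b \<in> bounded"
  shows "hat V M a \<otimes>\<^bsub>nonstandard_hull V M\<^esub> hat V M b = hat V M (a \<otimes> b)"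
proof -
  note a' = rep_hat[OF assms(1)] and b' = rep_hat[OF assms(2)]
  let ?a = "rep (hat V M a)" and ?b = "rep (hat V M b)"
  note c = bounded_carrier[OF assms(1)] bounded_carrier[OF assms(2)]
    bounded_carrier[OF a'(1)] bounded_carrier[OF b'(1)]
  \<comment> \<open>Changing one factor at a time leaves in each summand an infinitesimal times a
    bounded element.\<close>
  have "?a \<otimes> ?b \<ominus> a \<otimes> b = (?a \<ominus> a) \<otimes> ?b \<oplus> a \<otimes> (?b \<ominus> b)" using c by algebra
  moreover have "(?a \<ominus> a) \<otimes> ?b \<oplus> a \<otimes> (?b \<ominus> b) \<in> infinitesimal"
    by (intro infinitesimal_add infinitesimal_mult mult_infinitesimal a' b' assms)
  ultimately have "hat V M (?a \<otimes> ?b) = hat V M (a \<otimes> b)" using c by (simp add: hat_eq_iff)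
  then show ?thesis by (simp add: nonstandard_hull_def)
qed

lemma hull_add:
  assumes "a \<in> bounded" "b \<in> bounded"
  shows "hat V M a \<oplus>\<^bsub>nonstandard_hull V M\<^esub> hat V M b = hat V M (a \<oplus> b)"
proof -
  note a' = rep_hat[OF assms(1)] and b' = rep_hat[OF assms(2)]
  let ?a = "rep (hat V M a)" and ?b = "rep (hat V M b)"
  note c = bounded_carrier[OF assms(1)] bounded_carrier[OF assms(2)]
    bounded_carrier[OF a'(1)] bounded_carrier[OF b'(1)]
  have "(?a \<oplus> ?b) \<ominus> (a \<oplus> b) = (?a \<ominus> a) \<oplus> (?b \<ominus> b)" using c by algebra
  moreover have "(?a \<ominus> a) \<oplus> (?b \<ominus> b) \<in> infinitesimal"
    by (intro infinitesimal_add a' b')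
  ultimately have "hat V M (?a \<oplus> ?b) = hat V M (a \<oplus> b)" using c by (simp add: hat_eq_iff)
  then show ?thesis by (simp add: nonstandard_hull_def)
qed

lemma hull_adj:
  assumes "a \<in> bounded"
  shows "adj (nonstandard_hull V M) (hat V M a) = hat V M (adj M a)"
proof -
  note a' = rep_hat[OF assms]
  note c = bounded_carrier[OF assms] bounded_carrier[OF a'(1)]
  have "adj M (rep (hat V M a)) \<ominus> adj M a \<in> infinitesimal"
    using adj_diff[OF c(2,1)] infinitesimal_adj[OF a'(2)] by simp
  then show ?thesis using c by (simp add: nonstandard_hull_def hat_eq_iff adj_closed)
qed

lemma hull_carrier: "carrier (nonstandard_hull V M) = hat V M ` bounded"
  by (simp add: nonstandard_hull_def hat_set_def)

text \<open>Subtraction in the hull unfolds to a definite description of an additive inverse.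
  Existence and uniqueness of that inverse are checked on representatives, so no prior ring
  structure on the hull is invoked.\<close>

lemma hull_diff:
  assumes a: "a \<in> bounded" and b: "b \<in> bounded"
  shows "hat V M a \<ominus>\<^bsub>nonstandard_hull V M\<^esub> hat V M b = hat V M (a \<ominus> b)"
proof -
  let ?H = "nonstandard_hull V M"
  have zero: "\<zero> \<in> bounded" by (rule infinitesimal_bounded[OF infinitesimal_zero])
  have zero_H: "\<zero>\<^bsub>?H\<^esub> = hat V M \<zero>" by (simp add: nonstandard_hull_def)
  have nb: "\<ominus> b \<in> bounded"
    using bounded_diff[OF zero b] bounded_carrier[OF b] by (simp add: MR.minus_eq)
  have "inv\<^bsub>add_monoid ?H\<^esub> hat V M b = hat V M (\<ominus> b)"
    unfolding m_inv_def
  proof (rule the_equality)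
    show "hat V M (\<ominus> b) \<in> carrier (add_monoid ?H) \<and>
      hat V M b \<otimes>\<^bsub>add_monoid ?H\<^esub> hat V M (\<ominus> b) = \<one>\<^bsub>add_monoid ?H\<^esub> \<and>
      hat V M (\<ominus> b) \<otimes>\<^bsub>add_monoid ?H\<^esub> hat V M b = \<one>\<^bsub>add_monoid ?H\<^esub>"
      using nb b bounded_carrier[OF b]
      by (simp add: hull_carrier hull_add zero_H MR.r_neg MR.l_neg)
  next
    fix y
    assume "y \<in> carrier (add_monoid ?H) \<and> hat V M b \<otimes>\<^bsub>add_monoid ?H\<^esub> y = \<one>\<^bsub>add_monoid ?H\<^esub> \<and>
      y \<otimes>\<^bsub>add_monoid ?H\<^esub> hat V M b = \<one>\<^bsub>add_monoid ?H\<^esub>"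
    then obtain c where c: "c \<in> bounded" "y = hat V M c" "hat V M (b \<oplus> c) = hat V M \<zero>"
      using b by (auto simp: hull_carrier hull_add zero_H)
    note cc = bounded_carrier[OF c(1)] bounded_carrier[OF b]
    have "(b \<oplus> c) \<ominus> \<zero> = c \<ominus> (\<ominus> b)" using cc by algebra
    then show "y = hat V M (\<ominus> b)" using c cc by (simp add: hat_eq_iff)
  qed
  then show ?thesis using hull_add[OF a nb] by (simp add: a_minus_def a_inv_def[of ?H])
qed

text \<open>Anything infinitely close to a finite element is finite, so the finiteness built into
  \<open>hat_set\<close> holds automatically. This turns the set equalities of (i) and (ii) into
  their elementwise forms.\<close>

lemma hat_mem_hat_set_iff:
  assumes "a \<in> bounded" "X \<subseteq> carrier M"
  shows "hat V M a \<in> hat_set V M X \<longleftrightarrow> (\<exists>c\<in>X. hat V M a = hat V M c)"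
proof -
  have "c \<in> fin_part V M X" if c: "c \<in> X" "hat V M a = hat V M c" for c
  proof -
    have "c \<in> carrier M" using c assms by blast
    then have "c \<in> bounded"
      using bounded_if_near[OF _ assms(1)] hat_eq_iff[of c a] c bounded_carrier[OF assms(1)] by simp
    then show ?thesis using c by (simp add: fin_part_def)
  qed
  then show ?thesis unfolding hat_set_def image_iff by (auto simp: fin_part_def)
qed

section \<open>Self-adjoint elements, positive elements and order in the hull\<close>

lemma self_adjoint_carrier: "self_adjoint M \<subseteq> carrier M"
  by (auto simp: self_adjoint_def)

lemma positive_carrier: "positive M \<subseteq> carrier M"
  using self_adjoint_carrier by (auto simp: positive_def)

lemma fin_part_subset: "X \<subseteq> carrier M \<Longrightarrow> x \<in> fin_part V M X \<longleftrightarrow> x \<in> X \<and> x \<in> bounded"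
  by (auto simp: fin_part_def)

theorem self_adjoint_hull: "self_adjoint (nonstandard_hull V M) = hat_set V M (self_adjoint M)"
proof (intro equalityI subsetI)
  fix P assume P: "P \<in> self_adjoint (nonstandard_hull V M)"
  then obtain q where q: "q \<in> bounded" "P = hat V M q" by (auto simp: self_adjoint_def hull_carrier)
  note qM = bounded_carrier[OF q(1)]
  have "hat V M (adj M q) = hat V M q" using P q by (simp add: self_adjoint_def hull_adj)
  then have "adj M q \<ominus> q \<in> infinitesimal" using qM by (simp add: hat_eq_iff adj_closed)
  then obtain d where d: "d \<in> self_adjoint M" "d \<ominus> q \<in> infinitesimal"
    using near_self_adjoint[OF qM] by blast
  moreover have "d \<in> carrier M" using d self_adjoint_carrier by blast
  ultimately have "hat V M q = hat V M d" using hat_eq_iff[of d q] qM by simp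
  then show "P \<in> hat_set V M (self_adjoint M)"
    using d q hat_mem_hat_set_iff[OF q(1) self_adjoint_carrier] by blast
next
  fix P assume "P \<in> hat_set V M (self_adjoint M)"
  then obtain d where d: "d \<in> self_adjoint M" "d \<in> bounded" "P = hat V M d"
    by (auto simp: hat_set_def fin_part_subset[OF self_adjoint_carrier])
  then show "P \<in> self_adjoint (nonstandard_hull V M)"
    by (simp add: self_adjoint_def hull_carrier hull_adj)
qed

text \<open>Squares in the hull of self-adjoint elements are hats of d^2 with d self-adjoint and
  bounded. To see that these exhaust the hats of finite positive elements, the root of such an
  element must itself be finite, which the C*-identity provides.\<close>

theorem positive_hull: "positive (nonstandard_hull V M) = hat_set V M (positive M)"
proof -
  have "positive (nonstandard_hull V M)
      = {hat V M d \<otimes>\<^bsub>nonstandard_hull V M\<^esub> hat V M d | d. d \<in> self_adjoint M \<and> d \<in> bounded}"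
    unfolding positive_def self_adjoint_hull hat_set_def
    by (auto simp: fin_part_subset[OF self_adjoint_carrier])
  also have "\<dots> = {hat V M (d \<otimes> d) | d. d \<in> self_adjoint M \<and> d \<in> bounded}"
    using hull_mult by auto
  also have "\<dots> = hat_set V M (positive M)"
  proof -
    have "fin_part V M (positive M) = {d \<otimes> d | d. d \<in> self_adjoint M \<and> d \<in> bounded}"
      using self_adjoint_bounded_if_square_bounded bounded_mult
      unfolding set_eq_iff fin_part_subset[OF positive_carrier] unfolding positive_def by blast
    then show ?thesis unfolding hat_set_def by auto
  qed
  finally show ?thesis .
qed

text \<open>The representative \<open>a\<close> of the smaller class is prescribed and all freedom
  is left to the larger one. Hence the same equivalence serves when \<open>a\<close> is arbitrary
  and when it has been chosen positive beforehand.\<close>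

lemma below_hull_iff:
  assumes a: "a \<in> bounded" and m: "m \<in> carrier (nonstandard_hull V M)"
  shows "below (nonstandard_hull V M) (hat V M a) m \<longleftrightarrow>
    (\<exists>c\<in>positive M. c \<in> bounded \<and> m = hat V M (a \<oplus> c))"
proof -
  obtain b where b: "b \<in> bounded" "m = hat V M b" using m by (auto simp: hull_carrier)
  note M = bounded_carrier[OF a] bounded_carrier[OF b(1)]
  have "hat V M (b \<ominus> a) = hat V M c \<longleftrightarrow> m = hat V M (a \<oplus> c)" if "c \<in> bounded" for c
  proof -
    have "(b \<ominus> a) \<ominus> c = b \<ominus> (a \<oplus> c)" using M bounded_carrier[OF that] by algebra
    then show ?thesis using M bounded_carrier[OF that] b(2) by (simp add: hat_eq_iff)
  qed
  moreover have "hat V M (b \<ominus> a) \<in> hat_set V M (positive M)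
      \<longleftrightarrow> (\<exists>c\<in>positive M. c \<in> bounded \<and> hat V M (b \<ominus> a) = hat V M c)"
    unfolding hat_set_def image_iff Bex_def fin_part_subset[OF positive_carrier] by blast
  ultimately show ?thesis
    unfolding below_def positive_hull b(2) hull_diff[OF b(1) a] by blast
qed

lemma diff_add_cancel_left:
  "a \<in> carrier M \<Longrightarrow> c \<in> carrier M \<Longrightarrow> (a \<oplus> c) \<ominus> a = c"
  by algebra

theorem below_hull:
  assumes m: "m1 \<in> carrier (nonstandard_hull V M)" "m2 \<in> carrier (nonstandard_hull V M)"
  shows "below (nonstandard_hull V M) m1 m2 \<longleftrightarrow>
    (\<exists>a\<in>bounded. \<exists>b\<in>bounded. m1 = hat V M a \<and> m2 = hat V M b \<and> below M a b)"
proof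
  assume *: "below (nonstandard_hull V M) m1 m2"
  obtain a where a: "a \<in> bounded" "m1 = hat V M a" using m(1) by (auto simp: hull_carrier)
  then obtain c where c: "c \<in> positive M" "c \<in> bounded" "m2 = hat V M (a \<oplus> c)"
    using * below_hull_iff[OF a(1) m(2)] by auto
  have "below M a (a \<oplus> c)"
    using c(1) by (simp add: below_def diff_add_cancel_left bounded_carrier a(1) c(2))
  then show "\<exists>a\<in>bounded. \<exists>b\<in>bounded. m1 = hat V M a \<and> m2 = hat V M b \<and> below M a b"
    using a c bounded_add by blast
next
  assume "\<exists>a\<in>bounded. \<exists>b\<in>bounded. m1 = hat V M a \<and> m2 = hat V M b \<and> below M a b"
  then obtain a b where ab: "a \<in> bounded" "b \<in> bounded" "m1 = hat V M a" "m2 = hat V M b"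
    "b \<ominus> a \<in> positive M" by (auto simp: below_def)
  have "b = a \<oplus> (b \<ominus> a)" using bounded_carrier[OF ab(1)] bounded_carrier[OF ab(2)] by algebra
  then show "below (nonstandard_hull V M) m1 m2"
    using ab below_hull_iff[OF ab(1) m(2)] bounded_diff[OF ab(2,1)] by metis
qed

text \<open>The larger representative is not lifted separately from \<open>m2\<close>: taking it as
  a + c makes its difference from a exactly positive, not merely up to an infinitesimal, and closure
  under sums makes it positive too.\<close>

theorem positive_below_hull:
  assumes m: "m1 \<in> positive (nonstandard_hull V M)" "m2 \<in> carrier (nonstandard_hull V M)"
    and "below (nonstandard_hull V M) m1 m2"
  shows "\<exists>a\<in>fin_part V M (positive M). \<exists>b\<in>fin_part V M (positive M).
    m1 = hat V M a \<and> m2 = hat V M b \<and> below M a b"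
proof -
  obtain a where a: "a \<in> positive M" "a \<in> bounded" "m1 = hat V M a"
    using m(1) unfolding positive_hull by (auto simp: hat_set_def fin_part_subset[OF positive_carrier])
  then obtain c where c: "c \<in> positive M" "c \<in> bounded" "m2 = hat V M (a \<oplus> c)"
    using assms(3) below_hull_iff[OF a(2) m(2)] by auto
  have "below M a (a \<oplus> c)"
    using c(1) by (simp add: below_def diff_add_cancel_left bounded_carrier a(2) c(2))
  moreover have "a \<oplus> c \<in> positive M"
    using a(1) c(1) internal_sum_of_squares by (auto simp: positive_def[of M] simp del: MR.add.m_closed)
  ultimately show ?thesis
    using a c bounded_add[OF a(2) c(2)] by (metis fin_part_subset[OF positive_carrier])
qed

end

theorem proposition5:
  fixes V :: "('u, 'n) universe"
    and \<kappa> :: "'k rel"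
    and M :: "('n, 'n, 'n) star_algebra"
  assumes "saturated_nonstandard_universe \<kappa> V"
    and "internal_cstar_algebra V M"
  shows
    "((\<forall>a \<in> fin_part V M (carrier M).
         hat V M a \<in> positive (nonstandard_hull V M) \<longleftrightarrow> (\<exists>c \<in> positive M. hat V M a = hat V M c)) \<and>
      positive (nonstandard_hull V M) = hat_set V M (positive M)) \<and>
     ((\<forall>a \<in> fin_part V M (carrier M).
         hat V M a \<in> self_adjoint (nonstandard_hull V M) \<longleftrightarrow>
           (\<exists>c \<in> self_adjoint M. hat V M a = hat V M c)) \<and>
      self_adjoint (nonstandard_hull V M) = hat_set V M (self_adjoint M)) \<and>
     (\<forall>m1 \<in> carrier (nonstandard_hull V M). \<forall>m2 \<in> carrier (nonstandard_hull V M).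
        (below (nonstandard_hull V M) m1 m2 \<longleftrightarrow>
           (\<exists>a \<in> fin_part V M (carrier M). \<exists>b \<in> fin_part V M (carrier M).
              m1 = hat V M a \<and> m2 = hat V M b \<and> below M a b)) \<and>
        (below (nonstandard_hull V M) m1 m2 \<and> m1 \<in> positive (nonstandard_hull V M) \<longrightarrow>
           (\<exists>a \<in> fin_part V M (positive M). \<exists>b \<in> fin_part V M (positive M).
              m1 = hat V M a \<and> m2 = hat V M b \<and> below M a b)))"
proof -
  obtain A \<nu> where "[\<nu>] \<in> star_rel V {[i] | i. cstar_algebra (A i)}" "M = internal_structure V A \<nu>"
    using assms(2) unfolding internal_cstar_algebra_def by blast
  then interpret internal_cstar V A \<nu> M
    using assms(1) unfolding saturated_nonstandard_universe_def by unfold_locales auto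
  show ?thesis
  proof (intro conjI ballI impI)
    fix a assume "a \<in> fin_part V M (carrier M)"
    note hat_mem = hat_mem_hat_set_iff[OF this]
    show "hat V M a \<in> positive (nonstandard_hull V M) \<longleftrightarrow> (\<exists>c\<in>positive M. hat V M a = hat V M c)"
      unfolding positive_hull by (rule hat_mem[OF positive_carrier])
    show "hat V M a \<in> self_adjoint (nonstandard_hull V M) \<longleftrightarrow> (\<exists>c\<in>self_adjoint M. hat V M a = hat V M c)"
      unfolding self_adjoint_hull by (rule hat_mem[OF self_adjoint_carrier])
  qed (rule positive_hull self_adjoint_hull below_hull positive_below_hull; blast)+
qed

end
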